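(* For all real numbers $0<\varepsilon,\alpha,\eta<1$, every real $C>1$ and every integer $k\geq 4$, there exist $\delta,\gamma>0$ such that the following holds. Let $p=p(n)$ satisfy $p n^{1/k}\to\infty$ and $p=o(1)$ as $n\to\infty$, and let $n$ be sufficiently large. Then for every $q$ with $\alpha p\leq q\leq p$ and every $\beta\leq\gamma p^2n^{3/2}$ the following holds. Suppose that (i) $\Gamma=(V,E_\Gamma)$ is an $n$-vertex $(p,\beta)$-jumbled $3$-uniform hypergraph; (ii) $G=(V,E_G)$ is a spanning subhypergraph of $\Gamma$ with $|E_G|=q\binom{n}{3}$, and $G$ satisfies $\mathcal{Q}'(\eta,\delta,q)$ and $\mathrm{BDD}(k,C,q)$. Then for every linear connector-free $3$-uniform hypergraph $H$ on $k$ vertices we have $$\big||\mathcal{E}(H,G)|-n^kq^{|E(H)|}\big|<\varepsilon n^kq^{|E(H)|}.$$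
   Context: For a $3$-uniform hypergraph $\Gamma=(V,E)$, $X\subset\binom{V}{2}$ and $Y\subset V$, let $E_\Gamma(X,Y)$ be the set of edges (triples) of $\Gamma$ that contain a pair belonging to $X$ and a vertex belonging to $Y$, and $e_\Gamma(X,Y)=|E_\Gamma(X,Y)|$. $\Gamma$ is $(p,\beta)$-jumbled if for all $X\subset\binom{V}{2}$ and $Y\subset V$, $|e_\Gamma(X,Y)-p|X||Y||\leq\beta\sqrt{|X||Y|}$. A $3$-uniform hypergraph $G=(V,E)$ satisfies $\mathcal{Q}'(\eta,\delta,q)$ if for all $X\subset\binom{V}{2}$, $Y\subset V$ with $|X|\geq\eta\binom{|V|}{2}$ and $|Y|\geq\eta|V|$ we have $(1-\delta)q|X||Y|\leq|E_G(X,Y)|\leq(1+\delta)q|X||Y|$. For a pair $S\in\binom{V}{2}$, $N_G(S)=\{v\in V:S\cup\{v\}\in E\}$. $G$ (with $n=|V|$) satisfies $\mathrm{BDD}(k,C,q)$ if for all $1\leq r\leq k$ and all distinct $S_1,\dots,S_r\in\binom{V}{2}$, $|N_G(S_1)\cap\dots\cap N_G(S_r)|\leq Cnq^r$. A hypergraph is linear if any two edges share at most one vertex. An edge $e$ of a linear $3$-uniform hypergraph $H$ is a connector if there exist a vertex $v\in V(H)\setminus e$ and $3$ edges $e_1,e_2,e_3$ containing $v$ with $|e\cap e_i|=1$ for $i=1,2,3$; $H$ is connector-free if it has no connector. $\mathcal{E}(H,G)$ is the set of embeddings of $H$ into $G$, i.e. injective maps $\phi:V(H)\to V(G)$ such that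 $\{\phi(v_1),\phi(v_2),\phi(v_3)\}\in E(G)$ whenever $\{v_1,v_2,v_3\}\in E(H)$.
   Formalization: E(X,Y) is taken as the set of incidences (S,v) with S in X, v in Y and S∪{v} an edge, so an edge counts once per splitting; counting each triple once makes Q' and |E_G| = q·C(n,3) contradictory (take X all pairs, Y = V, δ = 1/2). *)

theory Defs
  imports Complex_Main "HOL-Library.Ramsey" "HOL-Library.FuncSet"
begin

text \<open>A 3-uniform hypergraph is given by a finite vertex set \<open>V\<close> and an edge set \<open>E\<close>;
  \<open>nsets V r\<close> is the set of \<open>r\<close>-element subsets of \<open>V\<close>.\<close>

definition uniform3 :: "'a set \<Rightarrow> 'a set set \<Rightarrow> bool" where
  "uniform3 V E \<longleftrightarrow> finite V \<and> E \<subseteq> nsets V 3"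

text \<open>\<open>E(X, Y)\<close>: an edge is recorded together with the way it splits into a pair from \<open>X\<close> and a
  vertex from \<open>Y\<close>, i.e. as the \<open>(S, v)\<close> in \<open>X \<times> Y\<close> with \<open>S \<union> {v} \<in> E\<close>; since edges have three
  elements, \<open>v \<notin> S\<close> is automatic when \<open>S\<close> is a pair. An edge that splits in several ways counts
  once for each of them. This is forced by the normalisation \<open>p |X| |Y|\<close>: for \<open>X\<close> the set of all
  pairs and \<open>Y = V\<close> one has \<open>p |X| |Y| \<approx> 3 p (n choose 3)\<close>, so counting every edge only once
  would contradict edge density \<open>p\<close>.\<close>

definition edges_between :: "'a set set \<Rightarrow> 'a set set \<Rightarrow> 'a set \<Rightarrow> ('a set \<times> 'a) set" where
  "edges_between E X Y = {(S, v). S \<in> X \<and> v \<in> Y \<and> S \<union> {v} \<in> E}"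

definition jumbled :: "real \<Rightarrow> real \<Rightarrow> 'a set \<Rightarrow> 'a set set \<Rightarrow> bool" where
  "jumbled p \<beta> V E \<longleftrightarrow>
     (\<forall>X Y. X \<subseteq> nsets V 2 \<longrightarrow> Y \<subseteq> V \<longrightarrow>
        \<bar>real (card (edges_between E X Y)) - p * real (card X) * real (card Y)\<bar>
          \<le> \<beta> * sqrt (real (card X) * real (card Y)))"

definition Q' :: "real \<Rightarrow> real \<Rightarrow> real \<Rightarrow> 'a set \<Rightarrow> 'a set set \<Rightarrow> bool" where
  "Q' \<eta> \<delta> q V E \<longleftrightarrow>
     (\<forall>X Y. X \<subseteq> nsets V 2 \<longrightarrow> Y \<subseteq> V \<longrightarrow>
        real (card X) \<ge> \<eta> * real (card V choose 2) \<longrightarrow>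
        real (card Y) \<ge> \<eta> * real (card V) \<longrightarrow>
        (1 - \<delta>) * q * real (card X) * real (card Y) \<le> real (card (edges_between E X Y)) \<and>
        real (card (edges_between E X Y)) \<le> (1 + \<delta>) * q * real (card X) * real (card Y))"

definition nbhd :: "'a set \<Rightarrow> 'a set set \<Rightarrow> 'a set \<Rightarrow> 'a set" where
  "nbhd V E S = {v \<in> V. S \<union> {v} \<in> E}"

text \<open>The \<open>r\<close> distinct pairs \<open>S\<^sub>1, \<dots>, S\<^sub>r\<close> are given as the \<open>r\<close>-element set \<open>P\<close> they form.\<close>

definition BDD :: "nat \<Rightarrow> real \<Rightarrow> real \<Rightarrow> 'a set \<Rightarrow> 'a set set \<Rightarrow> bool" where
  "BDD k C q V E \<longleftrightarrow>
     (\<forall>r P. 1 \<le> r \<longrightarrow> r \<le> k \<longrightarrow> P \<subseteq> nsets V 2 \<longrightarrow> card P = r \<longrightarrow>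
        real (card (\<Inter>S\<in>P. nbhd V E S)) \<le> C * real (card V) * q ^ r)"

definition linear_hypergraph :: "'a set set \<Rightarrow> bool" where
  "linear_hypergraph E \<longleftrightarrow> (\<forall>e\<in>E. \<forall>f\<in>E. e \<noteq> f \<longrightarrow> card (e \<inter> f) \<le> 1)"

definition connector :: "'a set \<Rightarrow> 'a set set \<Rightarrow> 'a set \<Rightarrow> bool" where
  "connector V E e \<longleftrightarrow> e \<in> E \<and>
     (\<exists>v \<in> V - e. \<exists>e1 \<in> E. \<exists>e2 \<in> E. \<exists>e3 \<in> E.
        e1 \<noteq> e2 \<and> e1 \<noteq> e3 \<and> e2 \<noteq> e3 \<and> v \<in> e1 \<and> v \<in> e2 \<and> v \<in> e3 \<and>
        card (e \<inter> e1) = 1 \<and> card (e \<inter> e2) = 1 \<and> card (e \<inter> e3) = 1)"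

definition connector_free :: "'a set \<Rightarrow> 'a set set \<Rightarrow> bool" where
  "connector_free V E \<longleftrightarrow> (\<nexists>e. connector V E e)"

text \<open>Embeddings are extensional functions on the vertex set of \<open>H\<close>, so that each map
  \<open>V(H) \<rightarrow> V(G)\<close> is counted exactly once.\<close>

definition embeddings ::
  "'b set \<Rightarrow> 'b set set \<Rightarrow> 'a set \<Rightarrow> 'a set set \<Rightarrow> ('b \<Rightarrow> 'a) set" where
  "embeddings VH EH VG EG =
     {\<phi> \<in> VH \<rightarrow>\<^sub>E VG. inj_on \<phi> VH \<and> (\<forall>e\<in>EH. \<phi> ` e \<in> EG)}"

end

(* Vertices of H are embedded one at a time. If w is embedded last, the number of its images is the
   size of the common neighbourhood of the images of the r pairs that form the link of w, and this
   is about n q^r for all but few tuples of pairs (a tuple property). Since H is linear and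
   connector-free, the union W of the link pairs spans no edge, so BDD shows that no map of W extends
   to too many embeddings of H - w; the few exceptional tuples are therefore negligible.

   The tuple property is a second moment computation: it only requires that most pairs of vertices
   u, v have about q^2 N common link pairs, where N is the number of all pairs, while the
   contribution of exceptional u, v is bounded by the 2r-th moments, which BDD controls because
   2r < k. For the pairs u, v one sums g(S,v) (g(S,u) - q), with g the indicator function of G, over
   arbitrary sets of (u, v): by Cauchy-Schwarz the factor g(S,v) is dominated by the indicator
   function of Gamma, which jumbledness replaces by the constant p, and then Q' applies. *)
theory Submission
  imports Defs "HOL-Analysis.Convex"
begin

section \<open>Finite sums\<close>

text \<open>\<open>Q'\<close> is silent about sparse sets, but the links and neighbourhoods that
  arise have density about q, and q tends to 0. The jumbled host gives control at that scale, and
  the condition on \<beta> is what this requires: replacing the indicator of Gamma by p costs order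
  \<beta> q n^2 sqrt(n N), with N about n^2/2, and this must be small against p q^2 n^3 N. So
  \<beta> must be small against p q n^(3/2), which \<alpha> p \<le> q turns into p^2 n^(3/2). The
  condition on p n^(1/k) enters as n q^k being large. It makes the vertices already used negligible
  among about n q^r candidates, and the mean codegree N q^2 at least 1, so that moments have the
  order of powers of means. Exceptional tuples are never singled out: absolute deviations are
  summed, and can then be multiplied by weights that are bounded uniformly. An edge inside W would
  spoil this. It would be settled by the map of W, while the deviations are summed over all maps of
  W, so its factor q would be lost.\<close>

lemma abs_sum_le_of_large_subsets:
  fixes f :: "'x \<Rightarrow> real"
  assumes fin: "finite A"
    and large: "\<And>X. X \<subseteq> A \<Longrightarrow> \<eta> * real (card A) \<le> real (card X) \<Longrightarrow> \<bar>sum f X\<bar> \<le> B"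
    and \<eta>: "\<eta> < 1" and big: "2 \<le> (1 - \<eta>) * real (card A)" and j: "2 \<le> 2 ^ j * (1 - \<eta>)"
    and X: "X \<subseteq> A"
  shows "\<bar>sum f X\<bar> \<le> 2 ^ (j + 1) * B"
proof -
  \<comment> \<open>A set of at most \<open>a\<close> elements has a complement of size at least
    \<open>\<eta> * card A\<close>. Rounding down loses at most a factor 2, which the slack in
    \<open>j\<close> makes up for: \<open>card A \<le> 2 ^ j * a\<close>.\<close>
  define a where "a = nat \<lfloor>(1 - \<eta>) * real (card A)\<rfloor>"
  have a_le: "real a \<le> (1 - \<eta>) * real (card A)" and a_ge: "(1 - \<eta>) * real (card A) / 2 \<le> real a"
    using big unfolding a_def by linarith+
  \<comment> \<open>A set of at most \<open>a\<close> elements is the difference of two large sets,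
    \<open>A\<close> and its complement, which gives \<open>2 * B\<close>. A larger set is cut into
    two sets of half the permitted size, and the bound doubles each time.\<close>
  have doubling: "\<bar>sum f X\<bar> \<le> 2 ^ i * (2 * B)" if "X \<subseteq> A" "card X \<le> 2 ^ i * a" for i X
    using that
  proof (induction i arbitrary: X)
    case 0
    have "real (card (A - X)) = real (card A) - real (card X)"
      using 0 fin by (simp add: card_Diff_subset finite_subset card_mono of_nat_diff)
    moreover have "real (card X) \<le> (1 - \<eta>) * real (card A)"
      using 0 a_le by simp
    ultimately have "\<bar>sum f (A - X)\<bar> \<le> B"
      by (intro large) (auto simp: algebra_simps)
    moreover have "\<bar>sum f A\<bar> \<le> B"
      using \<eta> mult_right_mono[of \<eta> 1 "real (card A)"] by (intro large) auto
    moreover have "sum f (A - X) = sum f A - sum f X"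
      using 0 fin by (simp add: sum_diff)
    ultimately show ?case by simp
  next
    case (Suc i)
    obtain Y where Y: "Y \<subseteq> X" "card Y = min (card X) (2 ^ i * a)"
      by (meson min.cobounded1 obtain_subset_with_card_n)
    have fX: "finite X" using Suc fin finite_subset by blast
    have "card (X - Y) \<le> 2 ^ i * a"
      using Suc.prems Y fX by (simp add: card_Diff_subset finite_subset)
    then have "\<bar>sum f (X - Y)\<bar> \<le> 2 ^ i * (2 * B)" "\<bar>sum f Y\<bar> \<le> 2 ^ i * (2 * B)"
      using Suc.IH[of "X - Y"] Suc.IH[of Y] Suc.prems Y by auto
    moreover have "sum f X = sum f Y + sum f (X - Y)"
      using Y fX by (simp add: sum_diff)
    ultimately show ?case by simp
  qed
  have "real (card A) \<le> 2 ^ j * (1 - \<eta>) / 2 * real (card A)"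
    using mult_right_mono[OF j, of "real (card A)"] by simp
  also have "\<dots> \<le> 2 ^ j * real a"
    using mult_left_mono[OF a_ge, of "2 ^ j"] by (simp add: algebra_simps)
  finally have "real (card A) \<le> real (2 ^ j * a)" by simp
  then have "card X \<le> 2 ^ j * a"
    using card_mono[OF fin X] by linarith
  from doubling[OF X this] show ?thesis by simp
qed

text \<open>Turns a bound that is uniform over subsets into an L1 bound: it is applied to the two
  parts on which \<open>f\<close> has constant sign.\<close>

lemma sum_abs_le_of_subsets:
  fixes f :: "'x \<Rightarrow> real"
  assumes fin: "finite A" and B: "\<And>X. X \<subseteq> A \<Longrightarrow> \<bar>sum f X\<bar> \<le> B"
  shows "(\<Sum>x\<in>A. \<bar>f x\<bar>) \<le> 2 * B"
proof -
  let ?X = "{x \<in> A. 0 \<le> f x}"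
  have "(\<Sum>x\<in>A. \<bar>f x\<bar>) = (\<Sum>x\<in>?X. \<bar>f x\<bar>) + (\<Sum>x\<in>A - ?X. \<bar>f x\<bar>)"
    using fin by (simp add: sum.subset_diff[of ?X A])
  also have "\<dots> = sum f ?X - sum f (A - ?X)"
    unfolding sum_negf[symmetric] diff_conv_add_uminus
    by (intro arg_cong2[of _ _ _ _ "(+)"] sum.cong) auto
  also have "\<dots> \<le> 2 * B"
    using B[of ?X] B[of "A - ?X"] by fastforce
  finally show ?thesis .
qed

lemma sum_sqrt_le:
  assumes "\<And>i. i \<in> A \<Longrightarrow> 0 \<le> f i"
  shows "(\<Sum>i\<in>A. sqrt (f i)) \<le> sqrt (real (card A) * sum f A)"
proof (rule real_le_rsqrt)
  have "(\<Sum>i\<in>A. 1 * sqrt (f i))\<^sup>2 \<le> (\<Sum>i\<in>A. 1\<^sup>2) * (\<Sum>i\<in>A. (sqrt (f i))\<^sup>2)"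
    by (rule Cauchy_Schwarz_ineq_sum)
  also have "(\<Sum>i\<in>A. (sqrt (f i))\<^sup>2) = sum f A"
    using assms by (intro sum.cong) auto
  finally show "(\<Sum>i\<in>A. sqrt (f i))\<^sup>2 \<le> real (card A) * sum f A" by simp
qed

text \<open>Being close to 1 on average says nothing about \<open>r\<close>-th powers where
  \<open>x i\<close> is huge; there the \<open>2 * r\<close>-th moment takes over. Pointwise, the
  square of \<open>x i ^ r - 1\<close> is at most \<open>\<bar>x i - 1\<bar>\<close> times
  \<open>real r * (1 + x i ^ (2 * r))\<close>, and Cauchy-Schwarz separates the two factors.\<close>

lemma sum_abs_power_minus_1_le:
  fixes x :: "'x \<Rightarrow> real"
  assumes x: "\<And>i. i \<in> A \<Longrightarrow> 0 \<le> x i"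
    and \<theta>: "(\<Sum>i\<in>A. \<bar>x i - 1\<bar>) \<le> \<theta> * real (card A)"
    and K: "(\<Sum>i\<in>A. x i ^ (2 * r)) \<le> K * real (card A)" and "0 \<le> \<theta>" "0 \<le> K"
  shows "(\<Sum>i\<in>A. \<bar>x i ^ r - 1\<bar>) \<le> sqrt (\<theta> * real r * (1 + K)) * real (card A)"
proof -
  have pt: "\<bar>x i ^ r - 1\<bar> \<le> sqrt \<bar>x i - 1\<bar> * sqrt (real r * (1 + x i ^ (2 * r)))" if "i \<in> A" for i
  proof -
    define y where "y = x i"
    define M where "M = max 1 y"
    have y: "0 \<le> y" and M: "1 \<le> M" "y \<le> M"
      using x[OF that] by (auto simp: y_def M_def)
    \<comment> \<open>One factor is expanded as y^r - 1 = (y - 1)(1 + ... + y^(r-1)), the other is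
      bounded trivially, so that exactly one factor \<open>\<bar>y - 1\<bar>\<close> remains for the
      hypothesis on \<theta>.\<close>
    have "\<bar>y ^ r - 1\<bar> * \<bar>y ^ r - 1\<bar> \<le> (\<bar>y - 1\<bar> * (real r * M ^ r)) * M ^ r"
    proof (rule mult_mono)
      have "y ^ i \<le> M ^ r" if "i < r" for i
        using y M that by (meson less_imp_le order_trans power_increasing power_mono)
      then have "(\<Sum>i<r. y ^ i) \<le> real r * M ^ r"
        using sum_bounded_above[of "{..<r}" "\<lambda>i. y ^ i" "M ^ r"] by simp
      then show "\<bar>y ^ r - 1\<bar> \<le> \<bar>y - 1\<bar> * (real r * M ^ r)"
        using y by (simp add: power_diff_1_eq abs_mult mult_left_mono sum_nonneg)
      have "y ^ r \<le> M ^ r" "1 \<le> M ^ r" "0 \<le> y ^ r" using y M by (auto intro: power_mono)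
      then show "\<bar>y ^ r - 1\<bar> \<le> M ^ r" by linarith
    qed (use M in auto)
    also have "\<dots> = \<bar>y - 1\<bar> * (real r * M ^ (2 * r))"
      by (simp add: power_add mult_2 mult.assoc)
    also have "\<dots> \<le> \<bar>y - 1\<bar> * (real r * (1 + y ^ (2 * r)))"
      using y by (intro mult_left_mono) (auto simp: M_def max_def)
    finally show ?thesis
      unfolding y_def[symmetric] real_sqrt_mult[symmetric]
      by (intro real_le_rsqrt) (simp add: power2_eq_square abs_mult_self_eq)
  qed
  have "(\<Sum>i\<in>A. \<bar>x i ^ r - 1\<bar>)\<^sup>2 \<le> (\<Sum>i\<in>A. sqrt \<bar>x i - 1\<bar> * sqrt (real r * (1 + x i ^ (2 * r))))\<^sup>2"
    by (intro power_mono sum_mono pt sum_nonneg) auto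
  also have "\<dots> \<le> (\<Sum>i\<in>A. (sqrt \<bar>x i - 1\<bar>)\<^sup>2) * (\<Sum>i\<in>A. (sqrt (real r * (1 + x i ^ (2 * r))))\<^sup>2)"
    by (rule Cauchy_Schwarz_ineq_sum)
  also have "\<dots> = (\<Sum>i\<in>A. \<bar>x i - 1\<bar>) * (real r * (real (card A) + (\<Sum>i\<in>A. x i ^ (2 * r))))"
    using x by (simp add: sum_distrib_left[symmetric] sum.distrib)
  also have "\<dots> \<le> (\<theta> * real (card A)) * (real r * (real (card A) + K * real (card A)))"
    using \<theta> K assms x by (intro mult_mono add_mono order_refl mult_nonneg_nonneg add_nonneg_nonneg sum_nonneg) auto
  also have "\<dots> = (\<theta> * real r * (1 + K)) * (real (card A))\<^sup>2"
    by (simp add: power2_eq_square algebra_simps)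
  finally have "(\<Sum>i\<in>A. \<bar>x i ^ r - 1\<bar>) \<le> sqrt ((\<theta> * real r * (1 + K)) * (real (card A))\<^sup>2)"
    by (rule real_le_rsqrt)
  then show ?thesis by (simp add: real_sqrt_mult)
qed

text \<open>Multiplying out the power would produce repeated elements, whereas \<open>BDD\<close>
  speaks of distinct pairs. For a sum s of 0/1 values, the sum over \<open>nsets P m\<close> is the
  binomial coefficient of s over m, which is at least (s/m)^m when s \<ge> m; the summand 1 covers s
  < m.\<close>

lemma power_le_sum_nsets:
  fixes f :: "'s \<Rightarrow> real"
  assumes fin: "finite P" and f: "\<And>S. S \<in> P \<Longrightarrow> f S \<in> {0, 1}" and m: "0 < m"
  shows "(\<Sum>S\<in>P. f S) ^ m \<le> real m ^ m * (1 + (\<Sum>Q\<in>nsets P m. \<Prod>S\<in>Q. f S))"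
proof -
  define A where "A = {S \<in> P. f S = 1}"
  have A: "A \<subseteq> P" "finite A" using fin by (auto simp: A_def)
  have "(\<Sum>S\<in>P. f S) = (\<Sum>S\<in>P. if S \<in> A then 1 else 0)"
    using f by (intro sum.cong) (auto simp: A_def)
  then have sum_f: "(\<Sum>S\<in>P. f S) = real (card A)"
    using A fin by (simp add: sum.If_cases Int_absorb1)
  have prod_f: "(\<Prod>S\<in>Q. f S) = (if Q \<in> nsets A m then 1 else 0)" if Q: "Q \<in> nsets P m" for Q
  proof (cases "Q \<subseteq> A")
    case True
    then show ?thesis using that by (auto simp: nsets_def A_def subset_iff intro!: prod.neutral)
  next
    case False
    then obtain S where "S \<in> Q" "f S = 0" using Q f unfolding nsets_def A_def by fastforce
    then show ?thesis using that False by (auto simp: nsets_def)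
  qed
  have "nsets A m \<subseteq> nsets P m" using A by (simp add: nsets_mono)
  then have "(\<Sum>Q\<in>nsets P m. \<Prod>S\<in>Q. f S) = real (card (nsets A m))"
    using fin by (simp add: prod_f sum.If_cases finite_imp_finite_nsets Int_absorb1)
  then have sum_prod: "(\<Sum>Q\<in>nsets P m. \<Prod>S\<in>Q. f S) = real (card A choose m)" by simp
  have "real (card A) ^ m \<le> real m ^ m * (1 + real (card A choose m))"
  proof (cases "m \<le> card A")
    case True
    from binomial_ge_n_over_k_pow_k[OF this, where ?'a = real] m
    have "real (card A) ^ m \<le> real m ^ m * real (card A choose m)"
      by (simp add: power_divide divide_simps mult.commute)
    also have "\<dots> \<le> real m ^ m * (1 + real (card A choose m))"
      by (intro mult_left_mono) auto
    finally show ?thesis .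
  next
    case False
    then have "real (card A) ^ m \<le> real m ^ m * 1"
      by (simp add: power_mono)
    also have "\<dots> \<le> real m ^ m * (1 + real (card A choose m))"
      by (intro mult_left_mono) auto
    finally show ?thesis .
  qed
  then show ?thesis by (simp add: sum_f sum_prod)
qed

section \<open>Codegrees and tuples in subgraphs of jumbled bipartite graphs\<close>

text \<open>The bipartite graph between pairs and vertices: \<open>P\<close> will be
  \<open>nsets V 2\<close>, and \<open>g\<close>, \<open>h\<close> the indicators of the edges
  \<open>S \<union> {v}\<close> of G and of Gamma. \<open>bdd\<close> is \<open>BDD\<close>, and
  \<open>disc\<close> is \<open>Q'\<close> once its size restriction has been removed.\<close>

locale sparse_bipartite =
  fixes P :: "'s set" and V :: "'v set" and g h :: "'s \<Rightarrow> 'v \<Rightarrow> real" and C q p \<beta> \<delta> :: real and k :: nat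
  assumes finP: "finite P" and finV: "finite V"
    and g01: "\<And>S v. g S v \<in> {0, 1}" and gh: "\<And>S v. g S v \<le> h S v"
    and C: "1 \<le> C" and q: "0 < q" "q \<le> 1" and p: "0 \<le> p" and \<beta>: "0 \<le> \<beta>" and \<delta>: "0 \<le> \<delta>"
    and bdd: "\<And>Q. \<lbrakk>Q \<subseteq> P; 1 \<le> card Q; card Q \<le> k\<rbrakk> \<Longrightarrow>
      (\<Sum>v\<in>V. \<Prod>S\<in>Q. g S v) \<le> C * real (card V) * q ^ card Q"
    and k: "1 \<le> k"
    and jumbled: "\<And>X Y. \<lbrakk>X \<subseteq> P; Y \<subseteq> V\<rbrakk> \<Longrightarrow>
      \<bar>\<Sum>S\<in>X. \<Sum>v\<in>Y. h S v - p\<bar> \<le> \<beta> * sqrt (real (card X) * real (card Y))"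
    and disc: "\<And>X Y. \<lbrakk>X \<subseteq> P; Y \<subseteq> V\<rbrakk> \<Longrightarrow>
      \<bar>\<Sum>S\<in>X. \<Sum>v\<in>Y. g S v - q\<bar> \<le> \<delta> * q * real (card P) * real (card V)"
begin

abbreviation "n \<equiv> real (card V)"
abbreviation "N \<equiv> real (card P)"

section \<open>Degrees and codegrees of vertices\<close>

definition deg :: "'v \<Rightarrow> real" where "deg v = (\<Sum>S\<in>P. g S v)"
definition codeg :: "'v \<Rightarrow> 'v \<Rightarrow> real" where "codeg u v = (\<Sum>S\<in>P. g S u * g S v)"

lemma g_bounds: "0 \<le> g S v" "g S v \<le> 1" "g S v * g S v = g S v"
  using g01[of S v] by auto

lemma deg_nonneg: "0 \<le> deg v" and codeg_nonneg: "0 \<le> codeg u v"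
  by (auto simp: deg_def codeg_def g_bounds intro!: sum_nonneg)

lemma pair_deg_le: "S \<in> P \<Longrightarrow> (\<Sum>v\<in>V. g S v) \<le> C * n * q"
  using bdd[of "{S}"] k by simp

lemma sum_deg_le: "(\<Sum>v\<in>V. deg v) \<le> N * (C * n * q)"
  unfolding deg_def by (subst sum.swap) (use sum_bounded_above[OF pair_deg_le] in auto)

lemma sum_codeg_le: "(\<Sum>u\<in>V. \<Sum>v\<in>V. codeg u v) \<le> N * (C * n * q)\<^sup>2"
proof -
  have "(\<Sum>u\<in>V. \<Sum>v\<in>V. codeg u v) = (\<Sum>u\<in>V. \<Sum>S\<in>P. \<Sum>v\<in>V. g S u * g S v)"
    unfolding codeg_def by (intro sum.cong refl sum.swap)
  also have "\<dots> = (\<Sum>S\<in>P. \<Sum>u\<in>V. \<Sum>v\<in>V. g S u * g S v)"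
    by (rule sum.swap)
  also have "\<dots> = (\<Sum>S\<in>P. (\<Sum>v\<in>V. g S v)\<^sup>2)"
    by (simp add: power2_eq_square sum_product)
  also have "\<dots> \<le> N * (C * n * q)\<^sup>2"
    by (rule sum_bounded_above) (auto intro!: power_mono pair_deg_le sum_nonneg simp: g_bounds)
  finally show ?thesis .
qed

lemma sum_abs_disc_le:
  assumes "W \<subseteq> V"
  shows "(\<Sum>S\<in>P. \<bar>\<Sum>u\<in>W. g S u - q\<bar>) \<le> 2 * (\<delta> * q * N * n)"
  by (intro sum_abs_le_of_subsets finP disc assms)

lemma sum_deg_close: "(\<Sum>v\<in>V. \<bar>deg v - q * N\<bar>) \<le> 2 * (\<delta> * q * N * n)"
proof -
  have "\<bar>\<Sum>v\<in>Y. deg v - q * N\<bar> \<le> \<delta> * q * N * n" if "Y \<subseteq> V" for Y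
  proof -
    have "(\<Sum>v\<in>Y. deg v - q * N) = (\<Sum>v\<in>Y. \<Sum>S\<in>P. g S v - q)"
      by (simp add: deg_def sum_subtractf)
    also have "\<dots> = (\<Sum>S\<in>P. \<Sum>v\<in>Y. g S v - q)" by (rule sum.swap)
    finally show ?thesis using disc[of P Y] that by simp
  qed
  then show ?thesis by (intro sum_abs_le_of_subsets finV)
qed

section \<open>Discrepancy inherited by links of vertices\<close>

lemma jumbled_indicator:
  assumes w: "\<And>S. S \<in> P \<Longrightarrow> w S \<in> {0, 1}" and Y: "Y \<subseteq> V"
  shows "\<bar>\<Sum>S\<in>P. w S * (\<Sum>v\<in>Y. h S v - p)\<bar> \<le> \<beta> * sqrt n * sqrt (\<Sum>S\<in>P. w S)"
proof -
  define X where "X = {S \<in> P. w S = 1}"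
  have X: "X \<subseteq> P" by (auto simp: X_def)
  have "(\<Sum>S\<in>P. w S) = (\<Sum>S\<in>X. 1)"
    using w finP by (intro sum.mono_neutral_cong_right) (auto simp: X_def)
  then have card_X: "(\<Sum>S\<in>P. w S) = real (card X)" by simp
  have "(\<Sum>S\<in>P. w S * (\<Sum>v\<in>Y. h S v - p)) = (\<Sum>S\<in>X. \<Sum>v\<in>Y. h S v - p)"
    using w finP by (intro sum.mono_neutral_cong_right) (auto simp: X_def)
  also have "\<bar>\<dots>\<bar> \<le> \<beta> * sqrt (real (card X) * real (card Y))"
    by (rule jumbled[OF X Y])
  also have "\<dots> \<le> \<beta> * sqrt (real (card X) * n)"
    using \<beta> card_mono[OF finV Y] by (intro mult_left_mono real_sqrt_le_mono) auto
  finally show ?thesis by (simp add: card_X real_sqrt_mult algebra_simps)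
qed

text \<open>The contribution of the jumbled weight \<open>h - p\<close> when it is summed against the square of
  \<open>\<Sum>u\<in>Z v. g S u - q\<close>: expanding the square leaves, for each pair \<open>u\<close>, \<open>u'\<close>, a sum over the
  common neighbourhood, which is dense enough for jumbledness to be effective.\<close>

lemma jumbled_square:
  assumes Z: "\<And>v. Z v \<subseteq> V"
  shows "(\<Sum>v\<in>V. \<Sum>S\<in>P. (h S v - p) * (\<Sum>u\<in>Z v. g S u - q)\<^sup>2) \<le> 4 * C * \<beta> * q * n\<^sup>2 * sqrt (n * N)"
proof -
  \<comment> \<open>The sets \<open>Z v\<close> vary with \<open>v\<close>. After expanding the
    square, this dependence becomes, for fixed \<open>u\<close> and \<open>u'\<close>, the
    restriction of \<open>v\<close> to \<open>Y u u'\<close>, a plain vertex set to which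
    jumbledness applies.\<close>
  define Y where "Y = (\<lambda>u u'. {v \<in> V. u \<in> Z v \<and> u' \<in> Z v})"
  define D where "D = (\<lambda>u u' S. \<Sum>v\<in>Y u u'. h S v - p)"
  have Y: "Y u u' \<subseteq> V" for u u' by (auto simp: Y_def)
  have D_eq: "(\<Sum>v\<in>V. (h S v - p) * (if v \<in> Y u u' then 1 else 0)) = D u u' S" for u u' S
    unfolding D_def using Y finV by (intro sum.mono_neutral_cong_right) auto
  have sq: "(\<Sum>u\<in>Z v. g S u - q)\<^sup>2 = (\<Sum>u\<in>V. \<Sum>u'\<in>V. (g S u - q) * (g S u' - q) * (if v \<in> Y u u' then 1 else 0))"
    if "v \<in> V" for v S
  proof -
    have "(\<Sum>u\<in>Z v. g S u - q) = (\<Sum>u\<in>V. if u \<in> Z v then g S u - q else 0)"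
      using Z finV by (simp add: sum.If_cases Int_absorb1)
    then have "(\<Sum>u\<in>Z v. g S u - q)\<^sup>2
      = (\<Sum>u\<in>V. \<Sum>u'\<in>V. (if u \<in> Z v then g S u - q else 0) * (if u' \<in> Z v then g S u' - q else 0))"
      by (simp add: power2_eq_square sum_product)
    also have "\<dots> = (\<Sum>u\<in>V. \<Sum>u'\<in>V. (g S u - q) * (g S u' - q) * (if v \<in> Y u u' then 1 else 0))"
      using that by (intro sum.cong) (auto simp: Y_def)
    finally show ?thesis .
  qed
  have "(\<Sum>v\<in>V. \<Sum>S\<in>P. (h S v - p) * (\<Sum>u\<in>Z v. g S u - q)\<^sup>2)
    = (\<Sum>v\<in>V. \<Sum>S\<in>P. \<Sum>u\<in>V. \<Sum>u'\<in>V. (g S u - q) * (g S u' - q) * ((h S v - p) * (if v \<in> Y u u' then 1 else 0)))"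
    by (intro sum.cong refl) (simp add: sq sum_distrib_left mult_ac)
  also have "\<dots> = (\<Sum>v\<in>V. \<Sum>u\<in>V. \<Sum>S\<in>P. \<Sum>u'\<in>V. (g S u - q) * (g S u' - q) * ((h S v - p) * (if v \<in> Y u u' then 1 else 0)))"
    by (intro sum.cong refl sum.swap)
  also have "\<dots> = (\<Sum>u\<in>V. \<Sum>v\<in>V. \<Sum>u'\<in>V. \<Sum>S\<in>P. (g S u - q) * (g S u' - q) * ((h S v - p) * (if v \<in> Y u u' then 1 else 0)))"
    by (subst sum.swap) (intro sum.cong refl sum.swap)
  also have "\<dots> = (\<Sum>u\<in>V. \<Sum>u'\<in>V. \<Sum>v\<in>V. \<Sum>S\<in>P. (g S u - q) * (g S u' - q) * ((h S v - p) * (if v \<in> Y u u' then 1 else 0)))"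
    by (intro sum.cong refl sum.swap)
  also have "\<dots> = (\<Sum>u\<in>V. \<Sum>u'\<in>V. \<Sum>S\<in>P. \<Sum>v\<in>V. (g S u - q) * (g S u' - q) * ((h S v - p) * (if v \<in> Y u u' then 1 else 0)))"
    by (intro sum.cong refl sum.swap)
  also have "\<dots> = (\<Sum>u\<in>V. \<Sum>u'\<in>V. \<Sum>S\<in>P. (g S u - q) * (g S u' - q) * D u u' S)"
    unfolding sum_distrib_left[symmetric] D_eq ..
  \<comment> \<open>The product of \<open>g S u - q\<close> and \<open>g S u' - q\<close> is a
    combination of four 0/1 weights on pairs, supported on the common link, the two links and all of
    \<open>P\<close>. Jumbledness costs the square root of the size of each.\<close>
  also have "\<dots> \<le> (\<Sum>u\<in>V. \<Sum>u'\<in>V. \<beta> * sqrt n * (sqrt (codeg u u') + q * sqrt (deg u) + q * sqrt (deg u') + q\<^sup>2 * sqrt N))"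
  proof (intro sum_mono)
    fix u u'
    have "\<bar>\<Sum>S\<in>P. g S u * g S u' * D u u' S\<bar> \<le> \<beta> * sqrt n * sqrt (codeg u u')"
      unfolding D_def codeg_def using g01 by (intro jumbled_indicator Y) (metis insert_iff mult_zero_left mult_zero_right mult_1 empty_iff)
    moreover have "\<bar>\<Sum>S\<in>P. g S u * D u u' S\<bar> \<le> \<beta> * sqrt n * sqrt (deg u)"
      "\<bar>\<Sum>S\<in>P. g S u' * D u u' S\<bar> \<le> \<beta> * sqrt n * sqrt (deg u')"
      unfolding D_def deg_def using g01 by (auto intro!: jumbled_indicator Y)
    then have "q * \<bar>\<Sum>S\<in>P. g S u * D u u' S\<bar> \<le> q * (\<beta> * sqrt n * sqrt (deg u))"
      "q * \<bar>\<Sum>S\<in>P. g S u' * D u u' S\<bar> \<le> q * (\<beta> * sqrt n * sqrt (deg u'))"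
      using q by (auto intro!: mult_left_mono)
    then have "- (q * (\<Sum>S\<in>P. g S u * D u u' S)) \<le> q * (\<beta> * sqrt n * sqrt (deg u))"
      "- (q * (\<Sum>S\<in>P. g S u' * D u u' S)) \<le> q * (\<beta> * sqrt n * sqrt (deg u'))"
      using q unfolding minus_mult_right by (meson abs_ge_minus_self less_imp_le mult_left_mono order_trans)+
    moreover have "\<bar>\<Sum>S\<in>P. 1 * D u u' S\<bar> \<le> \<beta> * sqrt n * sqrt (\<Sum>S\<in>P. 1)"
      unfolding D_def by (intro jumbled_indicator Y) auto
    then have "q\<^sup>2 * (\<Sum>S\<in>P. D u u' S) \<le> q\<^sup>2 * (\<beta> * sqrt n * sqrt N)"
      by (intro mult_left_mono) auto
    moreover have "(\<Sum>S\<in>P. (g S u - q) * (g S u' - q) * D u u' S)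
      = (\<Sum>S\<in>P. g S u * g S u' * D u u' S) - q * (\<Sum>S\<in>P. g S u * D u u' S)
        - q * (\<Sum>S\<in>P. g S u' * D u u' S) + q\<^sup>2 * (\<Sum>S\<in>P. D u u' S)"
      by (simp add: sum_distrib_left sum_subtractf[symmetric] sum.distrib[symmetric] algebra_simps power2_eq_square)
    ultimately show "(\<Sum>S\<in>P. (g S u - q) * (g S u' - q) * D u u' S)
      \<le> \<beta> * sqrt n * (sqrt (codeg u u') + q * sqrt (deg u) + q * sqrt (deg u') + q\<^sup>2 * sqrt N)"
      by (simp add: distrib_left mult_ac)
  qed
  also have "\<dots> = \<beta> * sqrt n * ((\<Sum>u\<in>V. \<Sum>u'\<in>V. sqrt (codeg u u')) + 2 * q * n * (\<Sum>u\<in>V. sqrt (deg u)) + q\<^sup>2 * n\<^sup>2 * sqrt N)"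
    by (simp add: sum_distrib_left[symmetric] sum.distrib power2_eq_square algebra_simps)
  \<comment> \<open>The codegree term dominates. The other three carry higher powers of
    \<open>q\<close> and are rounded up to it, which accounts for the constant 4.\<close>
  also have "\<dots> \<le> \<beta> * sqrt n * (C * q * n\<^sup>2 * sqrt N + 2 * q * n * (C * n * sqrt N) + C * q * n\<^sup>2 * sqrt N)"
  proof (intro mult_left_mono add_mono)
    have "(\<Sum>u\<in>V. \<Sum>u'\<in>V. sqrt (codeg u u')) = (\<Sum>x\<in>V \<times> V. sqrt (case x of (u, u') \<Rightarrow> codeg u u'))"
      by (simp add: sum.cartesian_product case_prod_unfold)
    also have "\<dots> \<le> sqrt (real (card (V \<times> V)) * (\<Sum>(u, u')\<in>V \<times> V. codeg u u'))"
      by (rule sum_sqrt_le) (auto simp: codeg_nonneg)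
    also have "\<dots> \<le> sqrt (n\<^sup>2 * (N * (C * n * q)\<^sup>2))"
      using sum_codeg_le by (intro real_sqrt_le_mono) (simp add: card_cartesian_product power2_eq_square sum.cartesian_product[symmetric] mult_left_mono)
    also have "\<dots> = C * q * n\<^sup>2 * sqrt N"
      using C q by (simp add: real_sqrt_mult power2_eq_square)
    finally show "(\<Sum>u\<in>V. \<Sum>u'\<in>V. sqrt (codeg u u')) \<le> C * q * n\<^sup>2 * sqrt N" .
    have "(\<Sum>u\<in>V. sqrt (deg u)) \<le> sqrt (n * (\<Sum>u\<in>V. deg u))"
      by (rule sum_sqrt_le) (auto simp: deg_nonneg)
    also have "\<dots> \<le> sqrt (n * (N * (C * n * q)))"
      by (intro real_sqrt_le_mono mult_left_mono sum_deg_le) auto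
    also have "\<dots> \<le> sqrt (n * (N * (C * n * C)))"
      using q C by (intro real_sqrt_le_mono mult_left_mono) auto
    also have "n * (N * (C * n * C)) = (C * n)\<^sup>2 * N"
      by (simp add: power2_eq_square)
    finally show "(\<Sum>u\<in>V. sqrt (deg u)) \<le> C * n * sqrt N"
      using C by (simp add: real_sqrt_mult)
    have "q * q \<le> C * q" using q C by (intro mult_right_mono) auto
    then show "q\<^sup>2 * n\<^sup>2 * sqrt N \<le> C * q * n\<^sup>2 * sqrt N"
      by (intro mult_right_mono) (auto simp: power2_eq_square)
  qed (use \<beta> q in auto)
  also have "\<dots> = 4 * C * \<beta> * q * n\<^sup>2 * sqrt (n * N)"
    by (simp add: real_sqrt_mult power2_eq_square algebra_simps)
  finally show ?thesis .
qed

text \<open>For each \<open>v\<close> separately, one factor of the square is bounded pointwise by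
  \<open>C * n * q\<close>, using \<open>BDD\<close> for single pairs, and the other is summed in
  absolute value over \<open>P\<close> by \<open>disc\<close>.\<close>

lemma disc_square:
  assumes Z: "\<And>v. Z v \<subseteq> V"
  shows "(\<Sum>v\<in>V. \<Sum>S\<in>P. (\<Sum>u\<in>Z v. g S u - q)\<^sup>2) \<le> 2 * C * \<delta> * q\<^sup>2 * N * n ^ 3"
proof -
  have "(\<Sum>S\<in>P. (\<Sum>u\<in>W. g S u - q)\<^sup>2) \<le> (C * n * q) * (2 * (\<delta> * q * N * n))" if W: "W \<subseteq> V" for W
  proof -
    have t: "\<bar>\<Sum>u\<in>W. g S u - q\<bar> \<le> C * n * q" if "S \<in> P" for S
    proof -
      have "real (card W) * q \<le> n * q"
        using q card_mono[OF finV W] by (intro mult_right_mono) auto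
      also have "\<dots> \<le> C * n * q" using C q by (simp add: mult_right_mono mult_le_cancel_right1)
      finally have "real (card W) * q \<le> C * n * q" .
      moreover have "(\<Sum>u\<in>W. g S u) \<le> (\<Sum>u\<in>V. g S u)"
        using W finV by (intro sum_mono2) (auto simp: g_bounds)
      moreover have "0 \<le> (\<Sum>u\<in>W. g S u)" by (auto simp: g_bounds intro: sum_nonneg)
      moreover have "0 \<le> real (card W) * q" using q by simp
      ultimately show ?thesis using pair_deg_le[OF that] by (simp add: sum_subtractf)
    qed
    have "(\<Sum>S\<in>P. (\<Sum>u\<in>W. g S u - q)\<^sup>2) \<le> (\<Sum>S\<in>P. (C * n * q) * \<bar>\<Sum>u\<in>W. g S u - q\<bar>)"
    proof (rule sum_mono)
      fix S assume "S \<in> P"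
      have "(\<Sum>u\<in>W. g S u - q)\<^sup>2 = \<bar>\<Sum>u\<in>W. g S u - q\<bar> * \<bar>\<Sum>u\<in>W. g S u - q\<bar>"
        by (simp add: power2_eq_square)
      also have "\<dots> \<le> (C * n * q) * \<bar>\<Sum>u\<in>W. g S u - q\<bar>"
        by (intro mult_right_mono t \<open>S \<in> P\<close>) auto
      finally show "(\<Sum>u\<in>W. g S u - q)\<^sup>2 \<le> (C * n * q) * \<bar>\<Sum>u\<in>W. g S u - q\<bar>" .
    qed
    also have "\<dots> = (C * n * q) * (\<Sum>S\<in>P. \<bar>\<Sum>u\<in>W. g S u - q\<bar>)"
      by (simp add: sum_distrib_left)
    also have "\<dots> \<le> (C * n * q) * (2 * (\<delta> * q * N * n))"
      using C q by (intro mult_left_mono sum_abs_disc_le W) auto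
    finally show ?thesis .
  qed
  then have "(\<Sum>v\<in>V. \<Sum>S\<in>P. (\<Sum>u\<in>Z v. g S u - q)\<^sup>2) \<le> n * ((C * n * q) * (2 * (\<delta> * q * N * n)))"
    using Z by (intro sum_bounded_above) auto
  then show ?thesis by (simp add: power2_eq_square power3_eq_cube algebra_simps)
qed

text \<open>Applying \<open>disc\<close> directly to the link of one \<open>v\<close> would leave
  the error \<delta> q N n, which exceeds the main term q^2 N n once q < \<delta>. Cauchy-Schwarz
  keeps a factor \<open>h\<close>, whose average \<open>p\<close> restores the missing density. The
  condition on \<kappa> merely says that the resulting product is small enough. The sets
  \<open>Z v\<close> may depend on \<open>v\<close>, which is what allows absolute values
  later.\<close>

lemma inheritance:
  assumes Z: "\<And>v. Z v \<subseteq> V"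
    and \<kappa>: "0 \<le> \<kappa>" "C * n * q * N * (p * (2 * C * \<delta> * q\<^sup>2 * N * n ^ 3) + 4 * C * \<beta> * q * n\<^sup>2 * sqrt (n * N))
      \<le> (\<kappa> * q\<^sup>2 * N * n\<^sup>2)\<^sup>2"
  shows "\<bar>\<Sum>v\<in>V. \<Sum>u\<in>Z v. codeg u v - q * deg v\<bar> \<le> \<kappa> * q\<^sup>2 * N * n\<^sup>2"
proof -
  define t where "t = (\<lambda>S v. \<Sum>u\<in>Z v. g S u - q)"
  have "(\<Sum>u\<in>Z v. codeg u v - q * deg v) = (\<Sum>S\<in>P. g S v * t S v)" for v
  proof -
    have "(\<Sum>u\<in>Z v. codeg u v - q * deg v) = (\<Sum>u\<in>Z v. \<Sum>S\<in>P. g S v * (g S u - q))"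
      by (simp add: codeg_def deg_def sum_distrib_left sum_subtractf[symmetric] algebra_simps)
    also have "\<dots> = (\<Sum>S\<in>P. \<Sum>u\<in>Z v. g S v * (g S u - q))" by (rule sum.swap)
    finally show ?thesis by (simp add: t_def sum_distrib_left)
  qed
  \<comment> \<open>Since \<open>g\<close> is 0/1, it equals its square: one copy forms the first
    Cauchy-Schwarz factor, the other stays with \<open>t\<close> and is then dominated by
    \<open>h\<close>.\<close>
  then have "(\<Sum>v\<in>V. \<Sum>u\<in>Z v. codeg u v - q * deg v)\<^sup>2 = (\<Sum>x\<in>V \<times> P. g (snd x) (fst x) * (g (snd x) (fst x) * t (snd x) (fst x)))\<^sup>2"
    by (simp add: sum.cartesian_product case_prod_unfold mult.assoc[symmetric] g_bounds)
  also have "\<dots> \<le> (\<Sum>x\<in>V \<times> P. (g (snd x) (fst x))\<^sup>2) * (\<Sum>x\<in>V \<times> P. (g (snd x) (fst x) * t (snd x) (fst x))\<^sup>2)"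
    by (rule Cauchy_Schwarz_ineq_sum)
  also have "\<dots> = (\<Sum>v\<in>V. deg v) * (\<Sum>v\<in>V. \<Sum>S\<in>P. g S v * (t S v)\<^sup>2)"
    by (simp add: deg_def sum.cartesian_product case_prod_unfold power_mult_distrib power2_eq_square[of "g _ _"] g_bounds)
  also have "\<dots> \<le> (N * (C * n * q)) * (p * (2 * C * \<delta> * q\<^sup>2 * N * n ^ 3) + 4 * C * \<beta> * q * n\<^sup>2 * sqrt (n * N))"
  proof (rule mult_mono)
    have "(\<Sum>v\<in>V. \<Sum>S\<in>P. g S v * (t S v)\<^sup>2) \<le> (\<Sum>v\<in>V. \<Sum>S\<in>P. h S v * (t S v)\<^sup>2)"
      by (intro sum_mono mult_right_mono gh) auto
    also have "\<dots> = p * (\<Sum>v\<in>V. \<Sum>S\<in>P. (t S v)\<^sup>2) + (\<Sum>v\<in>V. \<Sum>S\<in>P. (h S v - p) * (t S v)\<^sup>2)"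
      by (simp add: sum_distrib_left sum.distrib[symmetric] algebra_simps)
    also have "\<dots> \<le> p * (2 * C * \<delta> * q\<^sup>2 * N * n ^ 3) + 4 * C * \<beta> * q * n\<^sup>2 * sqrt (n * N)"
      unfolding t_def using p by (intro add_mono mult_left_mono disc_square jumbled_square Z)
    finally show "(\<Sum>v\<in>V. \<Sum>S\<in>P. g S v * (t S v)\<^sup>2) \<le> p * (2 * C * \<delta> * q\<^sup>2 * N * n ^ 3) + 4 * C * \<beta> * q * n\<^sup>2 * sqrt (n * N)" .
  qed (use C q sum_deg_le in \<open>auto intro!: sum_nonneg simp: g_bounds\<close>)
  also have "\<dots> \<le> (\<kappa> * q\<^sup>2 * N * n\<^sup>2)\<^sup>2"
    using \<kappa>(2) by (simp add: mult_ac)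
  finally have "\<bar>\<Sum>v\<in>V. \<Sum>u\<in>Z v. codeg u v - q * deg v\<bar> \<le> \<bar>\<kappa> * q\<^sup>2 * N * n\<^sup>2\<bar>"
    by (simp only: abs_le_square_iff)
  then show ?thesis
    using \<kappa>(1) by simp
qed

lemma sum_codeg_close:
  assumes \<kappa>: "0 \<le> \<kappa>" "C * n * q * N * (p * (2 * C * \<delta> * q\<^sup>2 * N * n ^ 3) + 4 * C * \<beta> * q * n\<^sup>2 * sqrt (n * N))
      \<le> (\<kappa> * q\<^sup>2 * N * n\<^sup>2)\<^sup>2"
  shows "(\<Sum>v\<in>V. \<Sum>u\<in>V. \<bar>codeg u v - q\<^sup>2 * N\<bar>) \<le> 2 * (\<kappa> + \<delta>) * q\<^sup>2 * N * n\<^sup>2"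
proof -
  \<comment> \<open>Choosing, for each \<open>v\<close>, the vertices \<open>u\<close> of
    nonnegative deviation and then their complement turns two signed bounds into an L1
    bound.\<close>
  let ?Z = "\<lambda>v. {u \<in> V. 0 \<le> codeg u v - q * deg v}"
  have "(\<Sum>u\<in>V. \<bar>codeg u v - q * deg v\<bar>)
    = (\<Sum>u\<in>?Z v. codeg u v - q * deg v) - (\<Sum>u\<in>V - ?Z v. codeg u v - q * deg v)" for v
  proof -
    have "(\<Sum>u\<in>V. \<bar>codeg u v - q * deg v\<bar>)
      = (\<Sum>u\<in>V - ?Z v. \<bar>codeg u v - q * deg v\<bar>) + (\<Sum>u\<in>?Z v. \<bar>codeg u v - q * deg v\<bar>)"
      by (rule sum.subset_diff) (auto simp: finV)
    also have "(\<Sum>u\<in>V - ?Z v. \<bar>codeg u v - q * deg v\<bar>) = (\<Sum>u\<in>V - ?Z v. - (codeg u v - q * deg v))"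
      by (intro sum.cong) auto
    also have "(\<Sum>u\<in>?Z v. \<bar>codeg u v - q * deg v\<bar>) = (\<Sum>u\<in>?Z v. codeg u v - q * deg v)"
      by (intro sum.cong) auto
    finally show ?thesis unfolding sum_negf by linarith
  qed
  then have "(\<Sum>v\<in>V. \<Sum>u\<in>V. \<bar>codeg u v - q * deg v\<bar>)
    = (\<Sum>v\<in>V. \<Sum>u\<in>?Z v. codeg u v - q * deg v) - (\<Sum>v\<in>V. \<Sum>u\<in>V - ?Z v. codeg u v - q * deg v)"
    by (simp only: sum_subtractf)
  moreover have "\<bar>\<Sum>v\<in>V. \<Sum>u\<in>?Z v. codeg u v - q * deg v\<bar> \<le> \<kappa> * q\<^sup>2 * N * n\<^sup>2"
    by (rule inheritance[OF _ \<kappa>]) auto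
  moreover have "\<bar>\<Sum>v\<in>V. \<Sum>u\<in>V - ?Z v. codeg u v - q * deg v\<bar> \<le> \<kappa> * q\<^sup>2 * N * n\<^sup>2"
    by (rule inheritance[OF _ \<kappa>]) auto
  ultimately have A: "(\<Sum>v\<in>V. \<Sum>u\<in>V. \<bar>codeg u v - q * deg v\<bar>) \<le> 2 * \<kappa> * q\<^sup>2 * N * n\<^sup>2"
    by linarith
  have "(\<Sum>v\<in>V. \<Sum>u\<in>V. \<bar>codeg u v - q\<^sup>2 * N\<bar>)
    \<le> (\<Sum>v\<in>V. \<Sum>u\<in>V. \<bar>codeg u v - q * deg v\<bar> + q * \<bar>deg v - q * N\<bar>)"
  proof (intro sum_mono)
    fix u v
    have "codeg u v - q\<^sup>2 * N = (codeg u v - q * deg v) + q * (deg v - q * N)"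
      by (simp add: algebra_simps power2_eq_square)
    then show "\<bar>codeg u v - q\<^sup>2 * N\<bar> \<le> \<bar>codeg u v - q * deg v\<bar> + q * \<bar>deg v - q * N\<bar>"
      using q abs_triangle_ineq[of "codeg u v - q * deg v" "q * (deg v - q * N)"] by (simp add: abs_mult)
  qed
  also have "\<dots> = (\<Sum>v\<in>V. \<Sum>u\<in>V. \<bar>codeg u v - q * deg v\<bar>) + n * q * (\<Sum>v\<in>V. \<bar>deg v - q * N\<bar>)"
    by (simp add: sum.distrib sum_distrib_left mult.assoc)
  also have "\<dots> \<le> 2 * \<kappa> * q\<^sup>2 * N * n\<^sup>2 + n * q * (2 * (\<delta> * q * N * n))"
    using q by (intro add_mono A mult_left_mono sum_deg_close) auto
  also have "\<dots> = 2 * (\<kappa> + \<delta>) * q\<^sup>2 * N * n\<^sup>2"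
    by (simp add: algebra_simps power2_eq_square)
  finally show ?thesis .
qed

section \<open>Moments of degrees and codegrees\<close>

lemma card_nsets_le: "real (card (nsets P m)) \<le> N ^ m"
proof (cases "m \<le> card P")
  case True
  then have "card P choose m \<le> card P ^ m" by (rule binomial_le_pow)
  then show ?thesis by (simp flip: of_nat_power)
qed (simp add: binomial_eq_0)

lemma nsets_bdd:
  assumes "Q \<in> nsets P m" "1 \<le> m" "m \<le> k"
  shows "(\<Sum>v\<in>V. \<Prod>S\<in>Q. g S v) \<le> C * n * q ^ m"
  using bdd[of Q] assms by (auto simp: nsets_def)

text \<open>Each set of \<open>m\<close> distinct pairs is handled by \<open>BDD\<close>, and
  \<open>big\<close> absorbs the additive 1 of \<open>power_le_sum_nsets\<close>. The constant has
  \<open>C\<^sup>2\<close> in place of \<open>C\<close> so that it agrees with that of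
  \<open>codeg_moment\<close>.\<close>

lemma deg_moment:
  assumes m: "1 \<le> m" "m \<le> k" and big: "1 \<le> N * q"
  shows "(\<Sum>v\<in>V. deg v ^ m) \<le> real k ^ k * (1 + C\<^sup>2) * n * (N * q) ^ m"
proof -
  have "(\<Sum>v\<in>V. deg v ^ m) \<le> (\<Sum>v\<in>V. real m ^ m * (1 + (\<Sum>Q\<in>nsets P m. \<Prod>S\<in>Q. g S v)))"
    unfolding deg_def using m g01 by (intro sum_mono power_le_sum_nsets finP) auto
  also have "\<dots> = real m ^ m * (n + (\<Sum>v\<in>V. \<Sum>Q\<in>nsets P m. \<Prod>S\<in>Q. g S v))"
    by (simp add: sum_distrib_left[symmetric] sum.distrib)
  also have "\<dots> = real m ^ m * (n + (\<Sum>Q\<in>nsets P m. \<Sum>v\<in>V. \<Prod>S\<in>Q. g S v))"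
    by (subst sum.swap) simp
  also have "\<dots> \<le> real m ^ m * (n + real (card (nsets P m)) * (C * n * q ^ m))"
    using m by (intro mult_left_mono add_mono order_refl sum_bounded_above nsets_bdd) auto
  also have "\<dots> \<le> real m ^ m * (n + N ^ m * (C * n * q ^ m))"
    using C q by (intro mult_left_mono add_mono order_refl mult_right_mono card_nsets_le) auto
  also have "\<dots> = real m ^ m * (n * 1 + C * n * (N * q) ^ m)"
    by (simp add: power_mult_distrib)
  also have "\<dots> \<le> real k ^ k * (n * (N * q) ^ m + C\<^sup>2 * n * (N * q) ^ m)"
  proof (intro mult_mono add_mono mult_left_mono mult_right_mono)
    show "real m ^ m \<le> real k ^ k"
      using m by (intro order_trans[OF power_mono power_increasing]) auto
    show "1 \<le> (N * q) ^ m" using big by simp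
    show "C \<le> C\<^sup>2" using C by (simp add: power2_eq_square)
  qed (use C q in auto)
  finally show ?thesis by (simp add: algebra_simps)
qed

text \<open>For a fixed set \<open>Q\<close> of pairs, the ordered pairs \<open>u\<close>,
  \<open>v\<close> that both lie in its common neighbourhood number the square of that
  neighbourhood's size. So \<open>BDD\<close> for \<open>m\<close> pairs is enough, although
  \<open>2 * m\<close> incidences are involved.\<close>

lemma codeg_moment:
  assumes m: "1 \<le> m" "m \<le> k" and big: "1 \<le> N * q\<^sup>2"
  shows "(\<Sum>v\<in>V. \<Sum>u\<in>V. codeg u v ^ m) \<le> real k ^ k * (1 + C\<^sup>2) * n\<^sup>2 * (N * q\<^sup>2) ^ m"
proof -
  have qm: "(q ^ m)\<^sup>2 = (q\<^sup>2) ^ m"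
    by (metis power_mult mult.commute)
  have gg: "g S u * g S v \<in> {0, 1}" for S u v
    using g01[of S u] g01[of S v] by auto
  have "(\<Sum>v\<in>V. \<Sum>u\<in>V. codeg u v ^ m)
    \<le> (\<Sum>v\<in>V. \<Sum>u\<in>V. real m ^ m * (1 + (\<Sum>Q\<in>nsets P m. \<Prod>S\<in>Q. g S u * g S v)))"
    unfolding codeg_def using m gg by (intro sum_mono power_le_sum_nsets finP) auto
  also have "\<dots> = real m ^ m * (n\<^sup>2 + (\<Sum>v\<in>V. \<Sum>u\<in>V. \<Sum>Q\<in>nsets P m. \<Prod>S\<in>Q. g S u * g S v))"
    by (simp add: sum_distrib_left[symmetric] sum.distrib power2_eq_square)
  also have "(\<Sum>v\<in>V. \<Sum>u\<in>V. \<Sum>Q\<in>nsets P m. \<Prod>S\<in>Q. g S u * g S v)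
    = (\<Sum>v\<in>V. \<Sum>Q\<in>nsets P m. \<Sum>u\<in>V. \<Prod>S\<in>Q. g S u * g S v)"
    by (intro sum.cong refl sum.swap)
  also have "\<dots> = (\<Sum>Q\<in>nsets P m. \<Sum>v\<in>V. \<Sum>u\<in>V. \<Prod>S\<in>Q. g S u * g S v)"
    by (rule sum.swap)
  also have "\<dots> = (\<Sum>Q\<in>nsets P m. (\<Sum>v\<in>V. \<Prod>S\<in>Q. g S v)\<^sup>2)"
    by (simp add: power2_eq_square sum_product prod.distrib mult.commute)
  also have "real m ^ m * (n\<^sup>2 + \<dots>) \<le> real m ^ m * (n\<^sup>2 + real (card (nsets P m)) * (C * n * q ^ m)\<^sup>2)"
    using m by (intro mult_left_mono add_mono order_refl sum_bounded_above power_mono nsets_bdd)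
      (auto intro!: sum_nonneg prod_nonneg simp: g_bounds)
  also have "\<dots> \<le> real m ^ m * (n\<^sup>2 + N ^ m * (C * n * q ^ m)\<^sup>2)"
    using C q by (intro mult_left_mono add_mono order_refl mult_right_mono card_nsets_le) auto
  also have "\<dots> = real m ^ m * (n\<^sup>2 * 1 + C\<^sup>2 * n\<^sup>2 * (N * q\<^sup>2) ^ m)"
    by (simp add: power_mult_distrib qm)
  also have "\<dots> \<le> real k ^ k * (n\<^sup>2 * (N * q\<^sup>2) ^ m + C\<^sup>2 * n\<^sup>2 * (N * q\<^sup>2) ^ m)"
  proof (intro mult_mono add_mono mult_left_mono mult_right_mono order_refl)
    show "real m ^ m \<le> real k ^ k"
      using m by (intro order_trans[OF power_mono power_increasing]) auto
    show "1 \<le> (N * q\<^sup>2) ^ m" using big by simp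
  qed (use C q in auto)
  finally show ?thesis by (simp add: algebra_simps)
qed

section \<open>Common neighbourhoods of tuples of pairs\<close>

lemma sum_tuples:
  assumes "finite I"
  shows "(\<Sum>f\<in>I \<rightarrow>\<^sub>E P. \<Sum>v\<in>V. \<Prod>i\<in>I. g (f i) v) = (\<Sum>v\<in>V. deg v ^ card I)"
proof -
  have "(\<Sum>f\<in>I \<rightarrow>\<^sub>E P. \<Prod>i\<in>I. g (f i) v) = deg v ^ card I" for v
    using prod_sum_PiE[of I "\<lambda>_. P" "\<lambda>_ S. g S v"] assms finP by (simp add: deg_def)
  then show ?thesis by (subst sum.swap) simp
qed

text \<open>Tuples may repeat pairs, so for fixed \<open>u\<close> and \<open>v\<close> the sum over
  tuples factorises into an exact power of the codegree. This is the second moment of the common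
  neighbourhood size, as \<open>sum_tuples\<close> is the first.\<close>

lemma sum_tuples_square:
  assumes "finite I"
  shows "(\<Sum>f\<in>I \<rightarrow>\<^sub>E P. (\<Sum>v\<in>V. \<Prod>i\<in>I. g (f i) v)\<^sup>2) = (\<Sum>v\<in>V. \<Sum>u\<in>V. codeg u v ^ card I)"
proof -
  have "(\<Sum>f\<in>I \<rightarrow>\<^sub>E P. \<Prod>i\<in>I. g (f i) u * g (f i) v) = codeg u v ^ card I" for u v
    using prod_sum_PiE[of I "\<lambda>_. P" "\<lambda>_ S. g S u * g S v"] assms finP by (simp add: codeg_def)
  then have eq: "codeg u v ^ card I = (\<Sum>f\<in>I \<rightarrow>\<^sub>E P. (\<Prod>i\<in>I. g (f i) v) * (\<Prod>i\<in>I. g (f i) u))" for u v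
    by (simp add: prod.distrib mult.commute)
  have "(\<Sum>v\<in>V. \<Sum>u\<in>V. codeg u v ^ card I)
    = (\<Sum>v\<in>V. \<Sum>f\<in>I \<rightarrow>\<^sub>E P. \<Sum>u\<in>V. (\<Prod>i\<in>I. g (f i) v) * (\<Prod>i\<in>I. g (f i) u))"
    unfolding eq by (intro sum.cong refl sum.swap)
  also have "\<dots> = (\<Sum>f\<in>I \<rightarrow>\<^sub>E P. \<Sum>v\<in>V. \<Sum>u\<in>V. (\<Prod>i\<in>I. g (f i) v) * (\<Prod>i\<in>I. g (f i) u))"
    by (rule sum.swap)
  finally show ?thesis by (simp add: power2_eq_square sum_product)
qed

text \<open>A variance bound. Closeness of degrees and codegrees is raised to the
  \<open>card I\<close>-th power by means of the \<open>2 * card I\<close>-th moments; these are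
  available because \<open>2 * card I \<le> k\<close>.\<close>

lemma tuples_close:
  assumes I: "finite I" "2 * card I \<le> k" and \<theta>: "0 \<le> \<theta>"
    and deg_close: "(\<Sum>v\<in>V. \<bar>deg v - q * N\<bar>) \<le> \<theta> * q * N * n"
    and codeg_close: "(\<Sum>v\<in>V. \<Sum>u\<in>V. \<bar>codeg u v - q\<^sup>2 * N\<bar>) \<le> \<theta> * q\<^sup>2 * N * n\<^sup>2"
    and big: "1 \<le> N * q\<^sup>2"
  defines "\<rho> \<equiv> sqrt (\<theta> * real k * (1 + real k ^ k * (1 + C\<^sup>2)))"
  shows "(\<Sum>f\<in>I \<rightarrow>\<^sub>E P. \<bar>(\<Sum>v\<in>V. \<Prod>i\<in>I. g (f i) v) - n * q ^ card I\<bar>) \<le> sqrt (3 * \<rho>) * n * (N * q) ^ card I"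
proof (cases "card I = 0")
  case True
  then have "I = {}" using I by simp
  then show ?thesis using \<theta> by (simp add: \<rho>_def)
next
  case False
  define r where "r = card I"
  define K where "K = real k ^ k * (1 + C\<^sup>2)"
  \<comment> \<open>The constant natural for this \<open>r\<close>; passing to \<open>k\<close> in
    \<rho> makes the conclusion uniform over the tuple length.\<close>
  define \<rho>r where "\<rho>r = sqrt (\<theta> * real r * (1 + K))"
  have r: "1 \<le> 2 * r" "2 * r \<le> k" using False I unfolding r_def by linarith+
  have N: "0 < N" using big q by (metis mult_eq_0_iff of_nat_0_less_iff of_nat_le_0_iff not_one_le_zero gr0I of_nat_0)
  have K: "0 \<le> K" by (simp add: K_def)
  have \<rho>r: "0 \<le> \<rho>r" "\<rho>r \<le> \<rho>"
    using \<theta> K r unfolding \<rho>r_def \<rho>_def K_def[symmetric]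
    by (auto intro!: mult_right_mono mult_left_mono)
  have "N * q\<^sup>2 \<le> N * q * 1"
    using q N by (simp add: power2_eq_square mult_left_le)
  then have big': "1 \<le> N * q" using big by simp
  have "(\<Sum>v\<in>V. \<bar>(deg v / (N * q)) ^ r - 1\<bar>) \<le> \<rho>r * n"
    unfolding \<rho>r_def
  proof (rule sum_abs_power_minus_1_le)
    have "(\<Sum>v\<in>V. \<bar>deg v / (N * q) - 1\<bar>) = (\<Sum>v\<in>V. \<bar>deg v - q * N\<bar>) / (N * q)"
      unfolding sum_divide_distrib using N q by (intro sum.cong) (auto simp: field_simps abs_if)
    then show "(\<Sum>v\<in>V. \<bar>deg v / (N * q) - 1\<bar>) \<le> \<theta> * n"
      using deg_close N q by (simp add: pos_divide_le_eq mult_ac)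
    show "(\<Sum>v\<in>V. (deg v / (N * q)) ^ (2 * r)) \<le> K * n"
      using deg_moment[OF r big'] N q
      by (simp add: power_divide sum_divide_distrib[symmetric] pos_divide_le_eq K_def mult_ac)
  qed (use \<theta> K deg_nonneg N q in auto)
  moreover have "(\<Sum>v\<in>V. \<bar>(deg v / (N * q)) ^ r - 1\<bar>) = (\<Sum>v\<in>V. \<bar>deg v ^ r - (N * q) ^ r\<bar>) / (N * q) ^ r"
    unfolding sum_divide_distrib using N q by (intro sum.cong) (auto simp: power_divide field_simps abs_if)
  ultimately have "(\<Sum>v\<in>V. \<bar>deg v ^ r - (N * q) ^ r\<bar>) \<le> \<rho>r * n * (N * q) ^ r"
    using N q by (simp add: pos_divide_le_eq)
  then have "\<bar>\<Sum>v\<in>V. deg v ^ r - (N * q) ^ r\<bar> \<le> \<rho>r * n * (N * q) ^ r"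
    by (rule order_trans[OF sum_abs])
  then have D: "n * (N * q) ^ r - \<rho>r * n * (N * q) ^ r \<le> (\<Sum>v\<in>V. deg v ^ r)"
    by (simp add: sum_subtractf)
  let ?x = "\<lambda>(v, u). codeg u v"
  have "(\<Sum>x\<in>V \<times> V. \<bar>(?x x / (N * q\<^sup>2)) ^ r - 1\<bar>) \<le> \<rho>r * real (card (V \<times> V))"
    unfolding \<rho>r_def
  proof (rule sum_abs_power_minus_1_le)
    have "(\<Sum>x\<in>V \<times> V. \<bar>?x x / (N * q\<^sup>2) - 1\<bar>) = (\<Sum>x\<in>V \<times> V. \<bar>?x x - q\<^sup>2 * N\<bar>) / (N * q\<^sup>2)"
      unfolding sum_divide_distrib using N q by (intro sum.cong) (auto simp: field_simps abs_if)
    also have "(\<Sum>x\<in>V \<times> V. \<bar>?x x - q\<^sup>2 * N\<bar>) = (\<Sum>v\<in>V. \<Sum>u\<in>V. \<bar>codeg u v - q\<^sup>2 * N\<bar>)"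
      by (simp add: sum.cartesian_product case_prod_unfold)
    finally show "(\<Sum>x\<in>V \<times> V. \<bar>?x x / (N * q\<^sup>2) - 1\<bar>) \<le> \<theta> * real (card (V \<times> V))"
      using codeg_close N q by (simp add: pos_divide_le_eq mult_ac power2_eq_square[of n] card_cartesian_product)
    have "(\<Sum>x\<in>V \<times> V. (?x x / (N * q\<^sup>2)) ^ (2 * r)) = (\<Sum>v\<in>V. \<Sum>u\<in>V. codeg u v ^ (2 * r)) / (N * q\<^sup>2) ^ (2 * r)"
      by (simp add: sum.cartesian_product case_prod_unfold power_divide sum_divide_distrib)
    then show "(\<Sum>x\<in>V \<times> V. (?x x / (N * q\<^sup>2)) ^ (2 * r)) \<le> K * real (card (V \<times> V))"
      using codeg_moment[OF r big] N q
      by (simp add: pos_divide_le_eq K_def mult_ac power2_eq_square[of n] card_cartesian_product)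
  qed (use \<theta> K codeg_nonneg N q in auto)
  moreover have "(\<Sum>x\<in>V \<times> V. \<bar>(?x x / (N * q\<^sup>2)) ^ r - 1\<bar>) = (\<Sum>x\<in>V \<times> V. \<bar>?x x ^ r - (N * q\<^sup>2) ^ r\<bar>) / (N * q\<^sup>2) ^ r"
    unfolding sum_divide_distrib using N q by (intro sum.cong) (auto simp: power_divide field_simps abs_if)
  ultimately have "(\<Sum>x\<in>V \<times> V. \<bar>?x x ^ r - (N * q\<^sup>2) ^ r\<bar>) \<le> \<rho>r * n\<^sup>2 * (N * q\<^sup>2) ^ r"
    using N q by (simp add: pos_divide_le_eq card_cartesian_product power2_eq_square[of n])
  then have "\<bar>\<Sum>x\<in>V \<times> V. ?x x ^ r - (N * q\<^sup>2) ^ r\<bar> \<le> \<rho>r * n\<^sup>2 * (N * q\<^sup>2) ^ r"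
    by (rule order_trans[OF sum_abs])
  moreover have "(\<Sum>x\<in>V \<times> V. ?x x ^ r) = (\<Sum>v\<in>V. \<Sum>u\<in>V. codeg u v ^ r)"
    by (simp add: sum.cartesian_product case_prod_unfold)
  ultimately have CD: "(\<Sum>v\<in>V. \<Sum>u\<in>V. codeg u v ^ r) \<le> n\<^sup>2 * (N * q\<^sup>2) ^ r + \<rho>r * n\<^sup>2 * (N * q\<^sup>2) ^ r"
    by (simp add: sum_subtractf card_cartesian_product power2_eq_square[of n])
  define c where "c = (\<lambda>f. \<Sum>v\<in>V. \<Prod>i\<in>I. g (f i) v)"
  have card_F: "real (card (I \<rightarrow>\<^sub>E P)) = N ^ r"
    using I by (simp add: card_PiE r_def)
  have split: "(N * q\<^sup>2) ^ r = N ^ r * q ^ r * q ^ r" "(N * q) ^ r = N ^ r * q ^ r"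
    by (simp_all add: power_mult_distrib power2_eq_square)
  have "(\<Sum>f\<in>I \<rightarrow>\<^sub>E P. (c f - n * q ^ r)\<^sup>2)
    = (\<Sum>f\<in>I \<rightarrow>\<^sub>E P. (c f)\<^sup>2) - 2 * (n * q ^ r) * (\<Sum>f\<in>I \<rightarrow>\<^sub>E P. c f) + N ^ r * (n * q ^ r)\<^sup>2"
    by (simp add: power2_diff sum.distrib sum_subtractf card_F sum_distrib_left mult_ac)
  \<comment> \<open>In units of the main term this is (1 + \<rho>) - 2(1 - \<rho>) + 1 = 3\<rho>,
    with \<open>\<rho>r\<close> in the place of \<rho>: the second moment is needed from above, the
    first from below.\<close>
  also have "\<dots> \<le> (n\<^sup>2 * (N * q\<^sup>2) ^ r + \<rho>r * n\<^sup>2 * (N * q\<^sup>2) ^ r)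
      - 2 * (n * q ^ r) * (n * (N * q) ^ r - \<rho>r * n * (N * q) ^ r) + N ^ r * (n * q ^ r)\<^sup>2"
    unfolding c_def sum_tuples[OF I(1)] sum_tuples_square[OF I(1)] r_def[symmetric]
    using q by (intro add_mono diff_mono mult_left_mono D CD order_refl) auto
  also have "\<dots> = 3 * \<rho>r * n\<^sup>2 * N ^ r * (q ^ r)\<^sup>2"
    unfolding split by (simp add: power2_eq_square algebra_simps)
  also have "\<dots> \<le> 3 * \<rho> * n\<^sup>2 * N ^ r * (q ^ r)\<^sup>2"
    using \<rho>r q by (intro mult_right_mono) auto
  finally have var: "(\<Sum>f\<in>I \<rightarrow>\<^sub>E P. (c f - n * q ^ r)\<^sup>2) \<le> 3 * \<rho> * n\<^sup>2 * N ^ r * (q ^ r)\<^sup>2" .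
  have "(\<Sum>f\<in>I \<rightarrow>\<^sub>E P. \<bar>c f - n * q ^ r\<bar>) = (\<Sum>f\<in>I \<rightarrow>\<^sub>E P. sqrt ((c f - n * q ^ r)\<^sup>2))"
    by simp
  also have "\<dots> \<le> sqrt (real (card (I \<rightarrow>\<^sub>E P)) * (\<Sum>f\<in>I \<rightarrow>\<^sub>E P. (c f - n * q ^ r)\<^sup>2))"
    by (rule sum_sqrt_le) auto
  also have "\<dots> \<le> sqrt (N ^ r * (3 * \<rho> * n\<^sup>2 * N ^ r * (q ^ r)\<^sup>2))"
    unfolding card_F by (intro real_sqrt_le_mono mult_left_mono var) auto
  also have "N ^ r * (3 * \<rho> * n\<^sup>2 * N ^ r * (q ^ r)\<^sup>2) = 3 * \<rho> * (n * (N * q) ^ r)\<^sup>2"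
    by (simp add: power_mult_distrib power2_eq_square)
  also have "sqrt \<dots> = sqrt (3 * \<rho>) * n * (N * q) ^ r"
    using q N by (simp add: real_sqrt_mult)
  finally show ?thesis by (simp add: c_def r_def)
qed

end

section \<open>Embeddings of linear connector-free hypergraphs\<close>

text \<open>The candidates for the image of \<open>w\<close>, including vertices already used:
  without the injectivity condition this is exactly a common neighbourhood.\<close>

definition extensions :: "'b set set \<Rightarrow> 'b \<Rightarrow> 'a set \<Rightarrow> 'a set set \<Rightarrow> ('b \<Rightarrow> 'a) \<Rightarrow> 'a set" where
  "extensions L w V E \<phi> = {x \<in> V. \<forall>e\<in>L. \<phi> ` (e - {w}) \<union> {x} \<in> E}"

lemma finite_embeddings: "finite V\<^sub>H \<Longrightarrow> finite V \<Longrightarrow> finite (embeddings V\<^sub>H E\<^sub>H V E)"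
  unfolding embeddings_def by (rule finite_subset[of _ "V\<^sub>H \<rightarrow>\<^sub>E V"]) (auto intro: finite_PiE)

text \<open>The predicate \<open>Q\<close> on the restriction to \<open>U\<close> lets the same
  count serve for all embeddings and for those with a prescribed map on a subset of
  \<open>U\<close>.\<close>

lemma card_embeddings_insert:
  fixes w :: 'b and V :: "'a set"
  assumes w: "w \<notin> U" and fin: "finite U" "finite V"
    and sub: "\<And>e. e \<in> E\<^sub>H \<Longrightarrow> e \<subseteq> insert w U"
  shows "card {\<phi> \<in> embeddings (insert w U) E\<^sub>H V E. Q (restrict \<phi> U)}
    = (\<Sum>\<phi> | \<phi> \<in> embeddings U {e \<in> E\<^sub>H. w \<notin> e} V E \<and> Q \<phi>. card (extensions {e \<in> E\<^sub>H. w \<in> e} w V E \<phi> - \<phi> ` U))"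
    (is "card ?A = (\<Sum>\<phi> | \<phi> \<in> ?B \<and> Q \<phi>. card (?X \<phi> - \<phi> ` U))")
proof -
  have img_upd: "\<phi>(w := x) ` e = \<phi> ` (e - {w}) \<union> {x}" if "w \<in> e" for \<phi> :: "'b \<Rightarrow> 'a" and x e
    using that by (auto simp: image_iff)
  have img: "\<phi> ` e = restrict \<phi> U ` (e - {w}) \<union> {\<phi> w}" if "w \<in> e" "e \<subseteq> insert w U" for \<phi> :: "'b \<Rightarrow> 'a" and e
    using that by (auto simp: image_iff restrict_def)
  have img': "restrict \<phi> U ` e = \<phi> ` e" if "e \<subseteq> U" for \<phi> :: "'b \<Rightarrow> 'a" and e
    using that by (auto simp: image_iff restrict_def)
  have img_upd': "\<phi>(w := x) ` e = \<phi> ` e" if "w \<notin> e" for \<phi> :: "'b \<Rightarrow> 'a" and x e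
    using that by (auto simp: image_iff)
  have sub': "e \<subseteq> U" if "e \<in> E\<^sub>H" "w \<notin> e" for e using sub[OF that(1)] that(2) by auto
  have "bij_betw (\<lambda>\<psi>. (restrict \<psi> U, \<psi> w)) ?A (SIGMA \<phi>:{\<phi> \<in> ?B. Q \<phi>}. ?X \<phi> - \<phi> ` U)"
  proof (rule bij_betw_byWitness[where f' = "\<lambda>(\<phi>, x). \<phi>(w := x)"])
    show "\<forall>\<psi>\<in>?A. (case (restrict \<psi> U, \<psi> w) of (\<phi>, x) \<Rightarrow> \<phi>(w := x)) = \<psi>"
      by (auto simp: embeddings_def fun_eq_iff PiE_def extensional_def)
    show "\<forall>a\<in>SIGMA \<phi>:{\<phi> \<in> ?B. Q \<phi>}. ?X \<phi> - \<phi> ` U.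
        (restrict (case a of (\<phi>, x) \<Rightarrow> \<phi>(w := x)) U, (case a of (\<phi>, x) \<Rightarrow> \<phi>(w := x)) w) = a"
      using w by (auto simp: embeddings_def fun_eq_iff PiE_def extensional_def)
    show "(\<lambda>\<psi>. (restrict \<psi> U, \<psi> w)) ` ?A \<subseteq> (SIGMA \<phi>:{\<phi> \<in> ?B. Q \<phi>}. ?X \<phi> - \<phi> ` U)"
    proof (rule image_subsetI)
      fix \<psi> assume \<psi>: "\<psi> \<in> ?A"
      then have \<psi>_edge: "\<psi> ` e \<in> E" if "e \<in> E\<^sub>H" for e using that by (auto simp: embeddings_def)
      have \<psi>_inj: "inj_on \<psi> (insert w U)" and \<psi>_V: "\<psi> \<in> insert w U \<rightarrow> V" "Q (restrict \<psi> U)"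
        using \<psi> by (auto simp: embeddings_def)
      have "restrict \<psi> U \<in> ?B"
        unfolding embeddings_def
      proof (intro CollectI conjI)
        show "\<forall>e\<in>{e \<in> E\<^sub>H. w \<notin> e}. restrict \<psi> U ` e \<in> E"
          using \<psi>_edge sub' img' by simp
      qed (use \<psi>_inj \<psi>_V in \<open>auto simp: inj_on_def\<close>)
      moreover have "\<psi> w \<in> ?X (restrict \<psi> U)"
      proof -
        have "restrict \<psi> U ` (e - {w}) \<union> {\<psi> w} \<in> E" if "e \<in> E\<^sub>H" "w \<in> e" for e
          using img[OF that(2) sub[OF that(1)], of \<psi>] \<psi>_edge[OF that(1)] by metis
        then show ?thesis using \<psi>_V unfolding extensions_def by blast
      qed
      moreover have "\<psi> w \<notin> restrict \<psi> U ` U"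
        using \<psi>_inj w by (auto simp: inj_on_def)
      ultimately show "(restrict \<psi> U, \<psi> w) \<in> (SIGMA \<phi>:{\<phi> \<in> ?B. Q \<phi>}. ?X \<phi> - \<phi> ` U)"
        using \<psi>_V by auto
    qed
    show "(\<lambda>(\<phi>, x). \<phi>(w := x)) ` (SIGMA \<phi>:{\<phi> \<in> ?B. Q \<phi>}. ?X \<phi> - \<phi> ` U) \<subseteq> ?A"
    proof clarify
      fix \<phi> x assume \<phi>: "\<phi> \<in> ?B" "Q \<phi>" and x: "x \<in> ?X \<phi>" "x \<notin> \<phi> ` U"
      have \<phi>': "\<phi> \<in> U \<rightarrow>\<^sub>E V" "inj_on \<phi> U" and \<phi>_edge: "\<And>e. e \<in> E\<^sub>H \<Longrightarrow> w \<notin> e \<Longrightarrow> \<phi> ` e \<in> E"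
        using \<phi> by (auto simp: embeddings_def)
      have "restrict (\<phi>(w := x)) U = \<phi>"
        using w \<phi>' by (auto simp: fun_eq_iff PiE_def extensional_def)
      moreover have "\<phi>(w := x) ` e \<in> E" if "e \<in> E\<^sub>H" for e
      proof (cases "w \<in> e")
        case True
        then show ?thesis
          using x(1) that unfolding img_upd[OF True] extensions_def by blast
      next
        case False
        then show ?thesis using \<phi>_edge[OF that False] img_upd'[OF False] by simp
      qed
      moreover have "\<phi>(w := x) \<in> insert w U \<rightarrow>\<^sub>E V"
        using \<phi>' x by (auto simp: extensions_def PiE_def extensional_def)
      moreover have "inj_on (\<phi>(w := x)) (insert w U)"
        using \<phi>' x w by (auto simp: inj_on_def)
      ultimately show "\<phi>(w := x) \<in> embeddings (insert w U) E\<^sub>H V E \<and> Q (restrict (\<phi>(w := x)) U)"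
        using \<phi> by (auto simp: embeddings_def simp del: fun_upd_apply)
    qed
  qed
  then have "card ?A = card (SIGMA \<phi>:{\<phi> \<in> ?B. Q \<phi>}. ?X \<phi> - \<phi> ` U)"
    by (rule bij_betw_same_card)
  also have "\<dots> = (\<Sum>\<phi> | \<phi> \<in> ?B \<and> Q \<phi>. card (?X \<phi> - \<phi> ` U))"
    using fin by (subst card_SigmaI) (auto simp: finite_embeddings extensions_def)
  finally show ?thesis .
qed

text \<open>Edges through \<open>w\<close> are determined by their link pairs, and \<phi> is
  injective, so the images of the link pairs are distinct and \<open>BDD\<close> applies. With no
  edge at \<open>w\<close> the bound is trivial; this case is separate since \<open>BDD\<close>
  starts at one pair.\<close>

lemma card_extensions_le:
  assumes V: "finite V" and bdd: "BDD k C q V E" and C: "1 \<le> C"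
    and L: "finite L" "card L \<le> k" "\<And>e. e \<in> L \<Longrightarrow> card e = 3" "\<And>e. e \<in> L \<Longrightarrow> w \<in> e" "\<And>e. e \<in> L \<Longrightarrow> e - {w} \<subseteq> U"
    and \<phi>: "\<phi> \<in> U \<rightarrow> V" "inj_on \<phi> U"
  shows "real (card (extensions L w V E \<phi>)) \<le> C * real (card V) * q ^ card L"
proof (cases "L = {}")
  case True
  have "real (card (extensions L w V E \<phi>)) \<le> real (card V)"
    using V by (auto simp: extensions_def intro!: card_mono)
  also have "\<dots> \<le> C * real (card V)" using C by (simp add: mult_le_cancel_right1)
  finally show ?thesis using True by simp
next
  case False
  define P where "P = (\<lambda>e. \<phi> ` (e - {w})) ` L"
  have "inj_on (\<lambda>e. \<phi> ` (e - {w})) L"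
  proof (rule inj_onI)
    fix e f assume ef: "e \<in> L" "f \<in> L" "\<phi> ` (e - {w}) = \<phi> ` (f - {w})"
    then have "e - {w} = f - {w}"
      using inj_on_image_eq_iff[OF \<phi>(2)] L(5) by blast
    then show "e = f" using L(4) ef by blast
  qed
  then have card_P: "card P = card L" unfolding P_def by (rule card_image)
  have "\<phi> ` (e - {w}) \<in> nsets V 2" if "e \<in> L" for e
  proof -
    have "finite e" using L(3)[OF that] card.infinite by fastforce
    then have "card (e - {w}) = 2" using L(3,4) that by simp
    moreover have "inj_on \<phi> (e - {w})" using \<phi>(2) L(5)[OF that] inj_on_subset by blast
    ultimately have "card (\<phi> ` (e - {w})) = 2" by (simp add: card_image)
    then show ?thesis using \<phi>(1) L(5)[OF that] \<open>finite e\<close> by (auto simp: nsets_def)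
  qed
  then have "P \<subseteq> nsets V 2" by (auto simp: P_def)
  moreover have "1 \<le> card L" using False L by (simp add: Suc_le_eq card_gt_0_iff)
  ultimately have "real (card (\<Inter>S\<in>P. nbhd V E S)) \<le> C * real (card V) * q ^ card L"
    using bdd card_P L(2) unfolding BDD_def by blast
  moreover have "(\<Inter>S\<in>P. nbhd V E S) = extensions L w V E \<phi>"
    using False by (auto simp: P_def extensions_def nbhd_def)
  ultimately show ?thesis by simp
qed

text \<open>Placing the vertices of \<open>U\<close> one by one, every edge yields its factor
  \<open>q\<close> when its last vertex is placed. This needs each edge to have a vertex in
  \<open>U\<close>: an edge inside \<open>W\<close> would already be decided by \<psi> and yield
  nothing.\<close>

lemma card_embeddings_over_independent_le:
  fixes W U :: "'b set" and V :: "'a set"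
  assumes V: "finite V" and bdd: "BDD k C q V E" and C: "1 \<le> C" and q: "0 < q"
    and U: "finite U" and W: "finite W" "W \<inter> U = {}"
    and "\<And>e. e \<in> E\<^sub>H \<Longrightarrow> e \<subseteq> W \<union> U" "\<And>e. e \<in> E\<^sub>H \<Longrightarrow> \<not> e \<subseteq> W" "\<And>e. e \<in> E\<^sub>H \<Longrightarrow> card e = 3"
    and "\<And>w. card {e \<in> E\<^sub>H. w \<in> e} \<le> k"
  shows "real (card {\<phi> \<in> embeddings (W \<union> U) E\<^sub>H V E. restrict \<phi> W = \<psi>}) \<le> (C * real (card V)) ^ card U * q ^ card E\<^sub>H"
  using U assms(7-)
proof (induction U arbitrary: E\<^sub>H rule: finite_induct)
  case empty
  then have "E\<^sub>H = {}" by auto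
  have "{\<phi> \<in> embeddings (W \<union> {}) E\<^sub>H V E. restrict \<phi> W = \<psi>} \<subseteq> {\<psi>}"
    by (auto simp: embeddings_def)
  from card_mono[OF _ this] have "card {\<phi> \<in> embeddings (W \<union> {}) E\<^sub>H V E. restrict \<phi> W = \<psi>} \<le> 1"
    by (simp del: restrict_apply)
  then show ?case using \<open>E\<^sub>H = {}\<close> by (simp del: restrict_apply)
next
  case (insert w U)
  define E' where "E' = {e \<in> E\<^sub>H. w \<notin> e}"
  define L where "L = {e \<in> E\<^sub>H. w \<in> e}"
  have "E\<^sub>H \<subseteq> Pow (W \<union> insert w U)" using insert.prems(2) by blast
  then have finE: "finite E\<^sub>H" using W(1) insert.hyps by (meson finite_Pow_iff finite_UnI finite_insert finite_subset)
  have w: "w \<notin> W \<union> U" using insert by auto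
  have card_E: "card E\<^sub>H = card E' + card L"
  proof -
    have "E\<^sub>H = E' \<union> L" "E' \<inter> L = {}" by (auto simp: E'_def L_def)
    then show ?thesis using finE by (metis card_Un_disjoint finite_Un)
  qed
  have IH: "real (card {\<phi> \<in> embeddings (W \<union> U) E' V E. restrict \<phi> W = \<psi>}) \<le> (C * real (card V)) ^ card U * q ^ card E'"
  proof (rule insert.IH)
    fix v
    have "card {e \<in> E'. v \<in> e} \<le> card {e \<in> E\<^sub>H. v \<in> e}"
      using finE by (intro card_mono) (auto simp: E'_def)
    then show "card {e \<in> E'. v \<in> e} \<le> k" using insert.prems(5)[of v] by simp
  qed (use insert.prems in \<open>auto simp: E'_def\<close>)
  have ext: "real (card (extensions L w V E \<phi> - \<phi> ` (W \<union> U))) \<le> C * real (card V) * q ^ card L"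
    if "\<phi> \<in> embeddings (W \<union> U) E' V E" for \<phi>
  proof -
    have "card (extensions L w V E \<phi> - \<phi> ` (W \<union> U)) \<le> card (extensions L w V E \<phi>)"
      using V by (intro card_mono) (auto simp: extensions_def)
    moreover have "real (card (extensions L w V E \<phi>)) \<le> C * real (card V) * q ^ card L"
    proof (rule card_extensions_le[OF V bdd C, where U = "W \<union> U"])
      show "e - {w} \<subseteq> W \<union> U" if "e \<in> L" for e using insert.prems(2) that unfolding L_def by auto
    qed (use insert.prems finE that in \<open>auto simp: L_def embeddings_def\<close>)
    ultimately show ?thesis by linarith
  qed
  have rr: "restrict (restrict \<phi> (W \<union> U)) W = restrict \<phi> W" for \<phi> :: "'b \<Rightarrow> 'a"
    by (auto simp: fun_eq_iff restrict_def)
  have "card {\<phi> \<in> embeddings (W \<union> insert w U) E\<^sub>H V E. restrict \<phi> W = \<psi>}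
    = card {\<phi> \<in> embeddings (insert w (W \<union> U)) E\<^sub>H V E. restrict (restrict \<phi> (W \<union> U)) W = \<psi>}"
    by (simp only: rr Un_insert_right)
  also have "\<dots> = (\<Sum>\<phi> | \<phi> \<in> embeddings (W \<union> U) E' V E \<and> restrict \<phi> W = \<psi>. card (extensions L w V E \<phi> - \<phi> ` (W \<union> U)))"
    unfolding E'_def L_def using insert.prems(2) insert.hyps
    by (intro card_embeddings_insert w V) (auto simp: W)
  finally have "real (card {\<phi> \<in> embeddings (W \<union> insert w U) E\<^sub>H V E. restrict \<phi> W = \<psi>})
    = (\<Sum>\<phi> | \<phi> \<in> embeddings (W \<union> U) E' V E \<and> restrict \<phi> W = \<psi>. real (card (extensions L w V E \<phi> - \<phi> ` (W \<union> U))))"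
    by simp
  also have "\<dots> \<le> real (card {\<phi> \<in> embeddings (W \<union> U) E' V E. restrict \<phi> W = \<psi>}) * (C * real (card V) * q ^ card L)"
    by (rule sum_bounded_above) (auto intro: ext)
  also have "\<dots> \<le> ((C * real (card V)) ^ card U * q ^ card E') * (C * real (card V) * q ^ card L)"
    using C q by (intro mult_right_mono IH) auto
  also have "\<dots> = (C * real (card V)) ^ card (insert w U) * q ^ card E\<^sub>H"
    using insert.hyps by (simp add: card_E power_add mult_ac)
  finally show ?case .
qed

text \<open>Two edges through \<open>w\<close> share no further vertex, so the link pairs are
  disjoint, and together they miss \<open>w\<close> itself, whence the strict inequality.\<close>

lemma linear_link:
  assumes H: "uniform3 V\<^sub>H E\<^sub>H" "linear_hypergraph E\<^sub>H"
  defines "L \<equiv> \<lambda>w. {e \<in> E\<^sub>H. w \<in> e}"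
  shows card_linear_link: "card (\<Union>e\<in>L w. e - {w}) = 2 * card (L w)"
    and linear_degree: "w \<in> V\<^sub>H \<Longrightarrow> 2 * card (L w) < card V\<^sub>H"
proof -
  have E: "finite e" "card e = 3" "e \<subseteq> V\<^sub>H" if "e \<in> E\<^sub>H" for e
    using H that by (auto simp: uniform3_def nsets_def)
  have "E\<^sub>H \<subseteq> Pow V\<^sub>H" using E by blast
  then have finE: "finite E\<^sub>H" using H by (meson finite_Pow_iff finite_subset uniform3_def)
  have "(e - {w}) \<inter> (f - {w}) = {}" if "e \<in> L w" "f \<in> L w" "e \<noteq> f" for e f
  proof (rule ccontr)
    assume "(e - {w}) \<inter> (f - {w}) \<noteq> {}"
    then obtain x where x: "x \<in> e \<inter> f" "x \<noteq> w" by blast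
    have "card {x, w} \<le> card (e \<inter> f)"
      using x that E by (intro card_mono) (auto simp: L_def)
    moreover have "card (e \<inter> f) \<le> 1"
      using H that by (auto simp: linear_hypergraph_def L_def)
    ultimately show False using x by simp
  qed
  then have "card (\<Union>e\<in>L w. e - {w}) = (\<Sum>e\<in>L w. card (e - {w}))"
    using finE E by (intro card_UN_disjoint) (auto simp: L_def)
  also have "\<dots> = (\<Sum>e\<in>L w. 2)"
    using E by (intro sum.cong) (auto simp: L_def)
  finally show card_link: "card (\<Union>e\<in>L w. e - {w}) = 2 * card (L w)" by simp
  assume "w \<in> V\<^sub>H"
  have "(\<Union>e\<in>L w. e - {w}) \<subset> V\<^sub>H" using E \<open>w \<in> V\<^sub>H\<close> by (auto simp: L_def)
  then have "card (\<Union>e\<in>L w. e - {w}) < card V\<^sub>H"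
    using H by (intro psubset_card_mono) (simp_all add: uniform3_def)
  then show "2 * card (L w) < card V\<^sub>H" by (simp only: card_link)
qed

text \<open>An edge inside the union of the link pairs of a vertex \<open>w\<close> meets three different edges
  through \<open>w\<close>, so it is a connector.\<close>

lemma connector_free_link_independent:
  assumes H: "uniform3 V\<^sub>H E\<^sub>H" "linear_hypergraph E\<^sub>H" "connector_free V\<^sub>H E\<^sub>H"
    and w: "w \<in> V\<^sub>H" and e: "e \<in> E\<^sub>H" "w \<notin> e"
  shows "\<not> e \<subseteq> (\<Union>f\<in>{f \<in> E\<^sub>H. w \<in> f}. f - {w})"
proof
  assume sub: "e \<subseteq> (\<Union>f\<in>{f \<in> E\<^sub>H. w \<in> f}. f - {w})"
  have "card e = 3" using H e by (auto simp: uniform3_def nsets_def)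
  then obtain x y z where xyz: "e = {x, y, z}" "x \<noteq> y" "x \<noteq> z" "y \<noteq> z"
    by (auto simp: card_3_iff)
  have "\<exists>f \<in> E\<^sub>H. w \<in> f \<and> u \<in> f" if "u \<in> e" for u using sub that by auto
  then obtain f where f: "\<And>u. u \<in> e \<Longrightarrow> f u \<in> E\<^sub>H \<and> w \<in> f u \<and> u \<in> f u" by metis
  have int: "e \<inter> f u = {u}" if "u \<in> e" for u
  proof -
    have "card (e \<inter> f u) \<le> 1"
      using H(2) f[OF that] e unfolding linear_hypergraph_def by blast
    moreover have "finite (e \<inter> f u)" using xyz by simp
    moreover have "u \<in> e \<inter> f u" using f that by simp
    ultimately show ?thesis
      by (metis One_nat_def card_le_Suc0_iff_eq is_singletonI' is_singleton_the_elem singletonD equals0D)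
  qed
  have mem: "x \<in> e" "y \<in> e" "z \<in> e" using xyz by auto
  have "f x \<noteq> f y \<and> f x \<noteq> f z \<and> f y \<noteq> f z"
    using int[OF mem(1)] int[OF mem(2)] int[OF mem(3)] xyz(2-) by auto
  moreover have "card (e \<inter> f x) = 1" "card (e \<inter> f y) = 1" "card (e \<inter> f z) = 1"
    using int mem by simp_all
  ultimately have "connector V\<^sub>H E\<^sub>H e"
    unfolding connector_def using e w f mem by blast
  then show False using H(3) by (auto simp: connector_free_def)
qed

section \<open>From tuples of pairs to embeddings\<close>

definition common_nbhd :: "'a set \<Rightarrow> 'a set set \<Rightarrow> 'i set \<Rightarrow> ('i \<Rightarrow> 'a set) \<Rightarrow> 'a set" where
  "common_nbhd V E L f = {x \<in> V. \<forall>e\<in>L. f e \<union> {x} \<in> E}"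

text \<open>The last argument fixes the type of the indices: a definition cannot quantify over an index
  type that does not occur in its own type.\<close>

definition tuple_uniform :: "nat \<Rightarrow> real \<Rightarrow> real \<Rightarrow> 'a set \<Rightarrow> 'a set set \<Rightarrow> 'i itself \<Rightarrow> bool" where
  "tuple_uniform k \<tau> q V E (_ :: 'i itself) \<longleftrightarrow> (\<forall>L :: 'i set. finite L \<longrightarrow> 2 * card L \<le> k \<longrightarrow>
     (\<Sum>f\<in>L \<rightarrow>\<^sub>E nsets V 2. \<bar>real (card (common_nbhd V E L f)) - real (card V) * q ^ card L\<bar>)
       \<le> \<tau> * real (card V) * (real (card V choose 2) * q) ^ card L)"

text \<open>Passes from maps of the link to tuples of pairs: once the images of the link pairs are
  known, each vertex of \<open>W\<close> has at most two possible images, namely the elements of the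
  image of a link pair containing it.\<close>

lemma sum_link_images_le:
  fixes w :: 'b and V :: "'a set" and F :: "('b set \<Rightarrow> 'a set) \<Rightarrow> real"
  assumes V: "finite V" and L: "finite L" "\<And>e. e \<in> L \<Longrightarrow> card (e - {w}) = 2"
    and F: "\<And>f. 0 \<le> F f"
  defines "W \<equiv> \<Union>e\<in>L. e - {w}"
  shows "(\<Sum>\<psi> | \<psi> \<in> W \<rightarrow>\<^sub>E V \<and> inj_on \<psi> W. F (\<lambda>e\<in>L. \<psi> ` (e - {w})))
    \<le> 2 ^ card W * (\<Sum>f\<in>L \<rightarrow>\<^sub>E nsets V 2. F f)"
proof -
  let ?B = "{\<psi>. \<psi> \<in> W \<rightarrow>\<^sub>E V \<and> inj_on \<psi> W}"
  let ?T = "\<lambda>\<psi>. \<lambda>e\<in>L. \<psi> ` (e - {w})"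
  have fin_e: "finite (e - {w})" if "e \<in> L" for e
    using L(2)[OF that] by (metis card.infinite zero_neq_numeral)
  have finW: "finite W" using L fin_e by (auto simp: W_def)
  have finB: "finite ?B"
    by (rule finite_subset[of _ "W \<rightarrow>\<^sub>E V"]) (auto intro: finite_PiE finW V)
  have finT: "finite (L \<rightarrow>\<^sub>E nsets V 2)"
    by (intro finite_PiE L finite_imp_finite_nsets V)
  have T: "?T ` ?B \<subseteq> L \<rightarrow>\<^sub>E nsets V 2"
  proof (rule image_subsetI, rule restrict_PiE_iff[THEN iffD2], rule ballI)
    fix \<psi> e assume \<psi>: "\<psi> \<in> ?B" and e: "e \<in> L"
    have "e - {w} \<subseteq> W" using e by (auto simp: W_def)
    moreover from this have "inj_on \<psi> (e - {w})" using \<psi> inj_on_subset by blast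
    ultimately show "\<psi> ` (e - {w}) \<in> nsets V 2"
      using \<psi> L(2)[OF e] fin_e[OF e] by (auto simp: nsets_def card_image)
  qed
  have fiber: "real (card {\<psi> \<in> ?B. ?T \<psi> = f}) \<le> 2 ^ card W" if f: "f \<in> L \<rightarrow>\<^sub>E nsets V 2" for f
  proof -
    have "\<exists>e \<in> L. x \<in> e - {w}" if "x \<in> W" for x using that by (auto simp: W_def)
    then obtain ed where ed: "\<And>x. x \<in> W \<Longrightarrow> ed x \<in> L \<and> x \<in> ed x - {w}" by metis
    have f2: "card (f (ed x)) = 2" "finite (f (ed x))" if "x \<in> W" for x
      using f ed[OF that] by (auto simp: nsets_def PiE_def Pi_def)
    have "{\<psi> \<in> ?B. ?T \<psi> = f} \<subseteq> (\<Pi>\<^sub>E x\<in>W. f (ed x))"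
    proof (intro subsetI PiE_I)
      fix \<psi> x assume "\<psi> \<in> {\<psi> \<in> ?B. ?T \<psi> = f}" and x: "x \<in> W"
      then have "f (ed x) = \<psi> ` (ed x - {w})" using ed[OF x] by auto
      then show "\<psi> x \<in> f (ed x)" using ed[OF x] by blast
    qed auto
    then have "card {\<psi> \<in> ?B. ?T \<psi> = f} \<le> card (\<Pi>\<^sub>E x\<in>W. f (ed x))"
      by (intro card_mono finite_PiE finW f2)
    also have "\<dots> = 2 ^ card W" using f2 by (simp add: card_PiE finW)
    finally have "real (card {\<psi> \<in> ?B. ?T \<psi> = f}) \<le> real (2 ^ card W)" by (rule of_nat_mono)
    then show ?thesis by simp
  qed
  have "(\<Sum>\<psi>\<in>?B. F (?T \<psi>)) = (\<Sum>f\<in>L \<rightarrow>\<^sub>E nsets V 2. \<Sum>\<psi> | \<psi> \<in> ?B \<and> ?T \<psi> = f. F (?T \<psi>))"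
    by (rule sum.group[OF finB finT T, symmetric])
  also have "\<dots> = (\<Sum>f\<in>L \<rightarrow>\<^sub>E nsets V 2. real (card {\<psi> \<in> ?B. ?T \<psi> = f}) * F f)"
    by (intro sum.cong refl) simp
  also have "\<dots> \<le> (\<Sum>f\<in>L \<rightarrow>\<^sub>E nsets V 2. 2 ^ card W * F f)"
    by (intro sum_mono mult_right_mono fiber F)
  finally show ?thesis by (simp add: sum_distrib_left)
qed

text \<open>The deviation for one \<phi> depends only on its restriction to \<open>W\<close>. Hence
  the sum over \<phi> is at most a uniform bound on the number of \<phi> per restriction times the
  sum over maps of \<open>W\<close>, which the tuple property controls. Excluding vertices already
  used changes each count by at most \<open>k\<close>, and \<open>big\<close> makes this
  negligible.\<close>

lemma embeddings_step:
  fixes w :: 'b and V :: "'a set" and E\<^sub>H :: "'b set set"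
  assumes V: "finite V" and bdd: "BDD k C q V E" and C: "1 \<le> C" and q: "0 < q" "q \<le> 1"
    and H: "uniform3 (insert w U) E\<^sub>H" "linear_hypergraph E\<^sub>H" "connector_free (insert w U) E\<^sub>H"
    and w: "w \<notin> U" and k: "card (insert w U) \<le> k"
    and tuples: "tuple_uniform k \<tau> q V E TYPE('b set)" and \<tau>: "0 \<le> \<tau>"
    and big: "real k \<le> \<tau> * real (card V) * q ^ k"
  defines "E' \<equiv> {e \<in> E\<^sub>H. w \<notin> e}" and "L \<equiv> {e \<in> E\<^sub>H. w \<in> e}"
  shows "\<bar>real (card (embeddings (insert w U) E\<^sub>H V E))
      - real (card V) * q ^ card L * real (card (embeddings U E' V E))\<bar>
    \<le> 2 * (2 * C) ^ k * \<tau> * real (card V) ^ card (insert w U) * q ^ card E\<^sub>H"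
proof -
  define n where "n = real (card V)"
  define r where "r = card L"
  define A where "A = embeddings U E' V E"
  define W where "W = (\<Union>e\<in>L. e - {w})"
  define X where "X = (\<lambda>\<phi>. extensions L w V E \<phi>)"
  define F where "F = (\<lambda>f. \<bar>real (card (common_nbhd V E L f)) - n * q ^ r\<bar>)"
  have finU: "finite U" using H by (simp add: uniform3_def)
  have E: "finite e" "card e = 3" "e \<subseteq> insert w U" if "e \<in> E\<^sub>H" for e
    using H that by (auto simp: uniform3_def nsets_def)
  have "E\<^sub>H \<subseteq> Pow (insert w U)" using E by blast
  then have finE: "finite E\<^sub>H" using finU by (meson finite_Pow_iff finite_insert finite_subset)
  have card_E: "card E\<^sub>H = card E' + r"
  proof -
    have "E\<^sub>H = E' \<union> L" "E' \<inter> L = {}" by (auto simp: E'_def L_def)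
    then show ?thesis unfolding r_def using finE by (metis card_Un_disjoint finite_Un)
  qed
  have card_W: "card W = 2 * r"
    unfolding W_def r_def L_def by (rule card_linear_link[OF H(1,2)])
  have W: "W \<subseteq> U" using E by (auto simp: W_def L_def)
  then have finW: "finite W" using finU finite_subset by blast
  have r: "2 * r \<le> card U" using card_mono[OF finU W] card_W by simp
  have card_wU: "card (insert w U) = card U + 1" using finU w by simp
  have deg: "card {e \<in> E'. v \<in> e} \<le> k" for v
  proof (cases "v \<in> insert w U")
    case True
    have "card {e \<in> E'. v \<in> e} \<le> card {e \<in> E\<^sub>H. v \<in> e}"
      using finE by (intro card_mono) (auto simp: E'_def)
    then show ?thesis using linear_degree[OF H(1,2) True] k by linarith
  next
    case False
    then have "{e \<in> E'. v \<in> e} = {}" using E unfolding E'_def by blast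
    then show ?thesis by (simp only: card.empty le0)
  qed
  have E'_sub: "e \<subseteq> U" if "e \<in> E'" for e using E(3)[of e] that by (auto simp: E'_def)
  have n: "0 \<le> n" by (simp add: n_def)
  have finA: "finite A" unfolding A_def by (rule finite_embeddings[OF finU V])
  have X_le: "card (X \<phi>) \<le> card V" for \<phi>
    unfolding X_def extensions_def using V by (intro card_mono) auto
  \<comment> \<open>The case of empty \<open>W\<close>: all embeddings have the same restriction,
    and an edge is never contained in the empty set.\<close>
  have card_A: "real (card A) \<le> (C * n) ^ card U * q ^ card E'"
  proof -
    have "real (card {\<phi> \<in> embeddings ({} \<union> U) E' V E. restrict \<phi> {} = (\<lambda>_. undefined)})
      \<le> (C * real (card V)) ^ card U * q ^ card E'"
      using E E(2)[of "{}"] E'_sub deg by (intro card_embeddings_over_independent_le[OF V bdd C q(1) finU]) (auto simp: E'_def)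
    then show ?thesis by (simp add: A_def n_def restrict_def)
  qed
  have "card (embeddings (insert w U) E\<^sub>H V E) = (\<Sum>\<phi>\<in>A. card (X \<phi> - \<phi> ` U))"
    using card_embeddings_insert[OF w finU V E(3), where Q = "\<lambda>_. True"]
    by (simp add: A_def X_def E'_def L_def)
  then have "real (card (embeddings (insert w U) E\<^sub>H V E)) - n * q ^ r * real (card A)
    = (\<Sum>\<phi>\<in>A. real (card (X \<phi> - \<phi> ` U)) - n * q ^ r)"
    by (simp add: sum_subtractf mult.commute)
  also have "\<bar>\<dots>\<bar> \<le> (\<Sum>\<phi>\<in>A. \<bar>real (card (X \<phi> - \<phi> ` U)) - n * q ^ r\<bar>)"
    by (rule sum_abs)
  also have "\<dots> \<le> (\<Sum>\<phi>\<in>A. \<bar>real (card (X \<phi>)) - n * q ^ r\<bar> + real k)"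
  proof (rule sum_mono)
    fix \<phi>
    have finX: "finite (X \<phi>)" unfolding X_def extensions_def using V by simp
    have "card (X \<phi> - \<phi> ` U) \<le> card (X \<phi>)" using finX by (intro card_mono) auto
    moreover have "card (X \<phi>) \<le> card (X \<phi> - \<phi> ` U) + card (\<phi> ` U)"
      using diff_card_le_card_Diff[of "\<phi> ` U" "X \<phi>"] finU by simp
    moreover have "card (\<phi> ` U) \<le> k" using card_image_le[OF finU, of \<phi>] k card_wU by simp
    ultimately show "\<bar>real (card (X \<phi> - \<phi> ` U)) - n * q ^ r\<bar> \<le> \<bar>real (card (X \<phi>)) - n * q ^ r\<bar> + real k"
      by linarith
  qed
  also have "\<dots> = (\<Sum>\<phi>\<in>A. \<bar>real (card (X \<phi>)) - n * q ^ r\<bar>) + real (card A) * real k"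
    by (simp add: sum.distrib)
  \<comment> \<open>The deviations and the vertices already used receive the same allowance, hence
    the leading factor 2 in the conclusion.\<close>
  also have "\<dots> \<le> (2 * C) ^ k * \<tau> * n ^ (card U + 1) * q ^ card E\<^sub>H + (2 * C) ^ k * \<tau> * n ^ (card U + 1) * q ^ card E\<^sub>H"
  proof (rule add_mono)
    have "real k \<le> \<tau> * n * q ^ k" using big by (simp add: n_def)
    also have "\<dots> \<le> \<tau> * n * q ^ r"
      using q \<tau> n r k card_wU by (intro mult_left_mono power_decreasing) auto
    finally have "real (card A) * real k \<le> ((C * n) ^ card U * q ^ card E') * (\<tau> * n * q ^ r)"
      using card_A n C q by (intro mult_mono) auto
    also have "\<dots> = C ^ card U * (\<tau> * n ^ (card U + 1) * q ^ card E\<^sub>H)"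
      by (simp add: card_E power_add power_mult_distrib mult_ac)
    also have "\<dots> \<le> (2 * C) ^ k * (\<tau> * n ^ (card U + 1) * q ^ card E\<^sub>H)"
    proof (rule mult_right_mono)
      have "C ^ card U \<le> C ^ k" using C k card_wU by (intro power_increasing) auto
      also have "\<dots> \<le> (2 * C) ^ k" using C by (intro power_mono) auto
      finally show "C ^ card U \<le> (2 * C) ^ k" .
    qed (use \<tau> n q in auto)
    finally show "real (card A) * real k \<le> (2 * C) ^ k * \<tau> * n ^ (card U + 1) * q ^ card E\<^sub>H"
      by (simp add: mult.assoc)
  next
    let ?B = "{\<psi>. \<psi> \<in> W \<rightarrow>\<^sub>E V \<and> inj_on \<psi> W}"
    let ?T = "\<lambda>\<psi>. \<lambda>e\<in>L. \<psi> ` (e - {w})"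
    have finB: "finite ?B"
      by (rule finite_subset[of _ "W \<rightarrow>\<^sub>E V"]) (auto intro: finite_PiE finW V)
    have res: "(\<lambda>\<phi>. restrict \<phi> W) ` A \<subseteq> ?B"
    proof (rule image_subsetI)
      fix \<phi> assume "\<phi> \<in> A"
      then have \<phi>: "\<phi> \<in> U \<rightarrow> V" "inj_on \<phi> U" by (auto simp: A_def embeddings_def)
      show "restrict \<phi> W \<in> ?B"
        using \<phi> W inj_on_subset[OF \<phi>(2) W] by (auto simp: inj_on_restrict_eq)
    qed
    have XF: "\<bar>real (card (X \<phi>)) - n * q ^ r\<bar> = F (?T (restrict \<phi> W))" for \<phi>
    proof -
      have "restrict \<phi> W ` (e - {w}) = \<phi> ` (e - {w})" if "e \<in> L" for e
        using that by (intro image_cong) (auto simp: W_def)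
      then have "X \<phi> = common_nbhd V E L (?T (restrict \<phi> W))"
        by (auto simp: X_def extensions_def common_nbhd_def simp del: image_restrict_eq)
      then show ?thesis by (simp add: F_def)
    qed
    \<comment> \<open>The only use of connector-freeness in this step: no edge of \<open>E'\<close>
      lies inside \<open>W\<close>, so all \<open>card E'\<close> factors \<open>q\<close> survive
      after \<psi> has been fixed.\<close>
    have fib: "real (card {\<phi> \<in> A. restrict \<phi> W = \<psi>}) \<le> (C * n) ^ (card U - 2 * r) * q ^ card E'" for \<psi>
    proof -
      have "real (card {\<phi> \<in> embeddings (W \<union> (U - W)) E' V E. restrict \<phi> W = \<psi>})
        \<le> (C * real (card V)) ^ card (U - W) * q ^ card E'"
      proof (rule card_embeddings_over_independent_le[OF V bdd C q(1)])
        show "\<not> e \<subseteq> W" if "e \<in> E'" for e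
          using connector_free_link_independent[OF H, of w e] that by (simp add: E'_def L_def W_def)
      qed (use finU finW E E'_sub deg in \<open>auto simp: E'_def\<close>)
      moreover have "W \<union> (U - W) = U" using W by blast
      ultimately show ?thesis
        using W finW by (simp add: A_def n_def card_Diff_subset card_W)
    qed
    have "(\<Sum>\<phi>\<in>A. \<bar>real (card (X \<phi>)) - n * q ^ r\<bar>) = (\<Sum>\<phi>\<in>A. F (?T (restrict \<phi> W)))"
      by (simp only: XF)
    also have "\<dots> = (\<Sum>\<psi>\<in>?B. \<Sum>\<phi> | \<phi> \<in> A \<and> restrict \<phi> W = \<psi>. F (?T (restrict \<phi> W)))"
      by (rule sum.group[OF finA finB res, symmetric])
    also have "\<dots> = (\<Sum>\<psi>\<in>?B. \<Sum>\<phi> | \<phi> \<in> A \<and> restrict \<phi> W = \<psi>. F (?T \<psi>))"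
      by (intro sum.cong refl) (auto simp del: restrict_apply)
    also have "\<dots> = (\<Sum>\<psi>\<in>?B. real (card {\<phi> \<in> A. restrict \<phi> W = \<psi>}) * F (?T \<psi>))"
      by (simp del: restrict_apply)
    also have "\<dots> \<le> (\<Sum>\<psi>\<in>?B. (C * n) ^ (card U - 2 * r) * q ^ card E' * F (?T \<psi>))"
      by (intro sum_mono mult_right_mono fib) (simp add: F_def)
    also have "\<dots> = (C * n) ^ (card U - 2 * r) * q ^ card E' * (\<Sum>\<psi>\<in>?B. F (?T \<psi>))"
      by (simp add: sum_distrib_left)
    also have "\<dots> \<le> (C * n) ^ (card U - 2 * r) * q ^ card E' * (2 ^ card W * (\<tau> * n * (real (card V choose 2) * q) ^ r))"
    proof (rule mult_left_mono)
      have "(\<Sum>\<psi>\<in>?B. F (?T \<psi>)) \<le> 2 ^ card W * (\<Sum>f\<in>L \<rightarrow>\<^sub>E nsets V 2. F f)"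
        unfolding W_def
        by (rule sum_link_images_le[OF V]) (use finE E in \<open>auto simp: L_def F_def\<close>)
      also have "(\<Sum>f\<in>L \<rightarrow>\<^sub>E nsets V 2. F f) \<le> \<tau> * n * (real (card V choose 2) * q) ^ r"
        unfolding F_def n_def r_def
        using tuples finE r k card_wU unfolding tuple_uniform_def r_def by (simp add: L_def)
      finally show "(\<Sum>\<psi>\<in>?B. F (?T \<psi>)) \<le> 2 ^ card W * (\<tau> * n * (real (card V choose 2) * q) ^ r)"
        by simp
    qed (use C n q in auto)
    also have "\<dots> = C ^ (card U - 2 * r) * ((4 * real (card V choose 2)) ^ r * (\<tau> * n ^ (card U - 2 * r + 1) * q ^ card E\<^sub>H))"
    proof -
      have "(2::real) ^ card W = 4 ^ r" by (simp add: card_W power_mult)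
      then show ?thesis by (simp add: card_E power_add power_mult_distrib mult_ac)
    qed
    \<comment> \<open>The factor 4^r counts the maps of \<open>W\<close> per tuple. Since there are
      at most n^2/2 pairs, half of it is cancelled, and \<open>2 ^ k\<close> suffices.\<close>
    also have "\<dots> \<le> C ^ k * ((2 ^ k * n ^ (2 * r)) * (\<tau> * n ^ (card U - 2 * r + 1) * q ^ card E\<^sub>H))"
    proof (intro mult_mono mult_right_mono)
      show "C ^ (card U - 2 * r) \<le> C ^ k" using C k card_wU by (intro power_increasing) auto
      have "2 * (card V choose 2) \<le> card V * card V"
        by (cases "card V") (auto simp: choose_two)
      then have "real (2 * (card V choose 2)) \<le> real (card V * card V)" by (rule of_nat_mono)
      then have "2 * real (card V choose 2) \<le> n\<^sup>2" by (simp add: n_def power2_eq_square)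
      then have "(4 * real (card V choose 2)) ^ r \<le> (2 * n\<^sup>2) ^ r"
        by (intro power_mono) auto
      also have "\<dots> = 2 ^ r * n ^ (2 * r)" by (simp add: power_mult_distrib power_mult)
      also have "\<dots> \<le> 2 ^ k * n ^ (2 * r)"
        using r k card_wU n by (intro mult_right_mono power_increasing) auto
      finally show "(4 * real (card V choose 2)) ^ r \<le> 2 ^ k * n ^ (2 * r)" .
    qed (use C n \<tau> q in auto)
    also have "\<dots> = (2 * C) ^ k * \<tau> * (n ^ (2 * r) * n ^ (card U - 2 * r + 1)) * q ^ card E\<^sub>H"
      by (simp add: power_mult_distrib mult_ac)
    also have "n ^ (2 * r) * n ^ (card U - 2 * r + 1) = n ^ (card U + 1)"
      using r by (simp add: power_add[symmetric])
    finally show "(\<Sum>\<phi>\<in>A. \<bar>real (card (X \<phi>)) - n * q ^ r\<bar>) \<le> (2 * C) ^ k * \<tau> * n ^ (card U + 1) * q ^ card E\<^sub>H" .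
  qed
  finally show ?thesis
    unfolding card_wU by (simp add: n_def r_def A_def mult_ac)
qed

lemma connector_mono:
  assumes "connector U E' e" and sub: "U \<subseteq> V" "E' \<subseteq> E"
  shows "connector V E e"
proof -
  obtain v e1 e2 e3 where *: "e \<in> E'" "v \<in> U - e" "e1 \<in> E'" "e2 \<in> E'" "e3 \<in> E'"
    and **: "e1 \<noteq> e2 \<and> e1 \<noteq> e3 \<and> e2 \<noteq> e3 \<and> v \<in> e1 \<and> v \<in> e2 \<and> v \<in> e3 \<and>
        card (e \<inter> e1) = 1 \<and> card (e \<inter> e2) = 1 \<and> card (e \<inter> e3) = 1"
    using assms(1) unfolding connector_def by (elim conjE bexE) (rule that; simp)
  have "e \<in> E" "v \<in> V - e" "e1 \<in> E" "e2 \<in> E" "e3 \<in> E" using * sub by auto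
  with ** show ?thesis
    unfolding connector_def by (intro conjI[OF \<open>e \<in> E\<close>] bexI[of _ v] bexI[of _ e1] bexI[of _ e2] bexI[of _ e3])
qed

text \<open>Adding a vertex multiplies both the old main term and the old error by
  \<open>n * q ^ r\<close> and contributes a new error of the same relative size. Relative errors
  therefore add, once per vertex of H.\<close>

lemma embeddings_count:
  fixes V :: "'a set" and V\<^sub>H :: "'b set"
  assumes V: "finite V" and bdd: "BDD k C q V E" and C: "1 \<le> C" and q: "0 < q" "q \<le> 1"
    and tuples: "tuple_uniform k \<tau> q V E TYPE('b set)" and \<tau>: "0 \<le> \<tau>"
    and big: "real k \<le> \<tau> * real (card V) * q ^ k"
    and H: "uniform3 V\<^sub>H E\<^sub>H" "linear_hypergraph E\<^sub>H" "connector_free V\<^sub>H E\<^sub>H" and k: "card V\<^sub>H \<le> k"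
  shows "\<bar>real (card (embeddings V\<^sub>H E\<^sub>H V E)) - real (card V) ^ card V\<^sub>H * q ^ card E\<^sub>H\<bar>
    \<le> real (card V\<^sub>H) * (2 * (2 * C) ^ k * \<tau>) * real (card V) ^ card V\<^sub>H * q ^ card E\<^sub>H"
proof -
  define n where "n = real (card V)"
  define M where "M = 2 * (2 * C) ^ k * \<tau>"
  have "finite V\<^sub>H" using H by (simp add: uniform3_def)
  then have "\<bar>real (card (embeddings V\<^sub>H E\<^sub>H V E)) - n ^ card V\<^sub>H * q ^ card E\<^sub>H\<bar>
    \<le> real (card V\<^sub>H) * M * n ^ card V\<^sub>H * q ^ card E\<^sub>H"
    using H k
  proof (induction V\<^sub>H arbitrary: E\<^sub>H rule: finite_induct)
    case empty
    then have "E\<^sub>H = {}" by (auto simp: uniform3_def nsets_empty_iff)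
    then have "embeddings {} E\<^sub>H V E = {\<lambda>_. undefined}" by (auto simp: embeddings_def)
    then show ?case using \<open>E\<^sub>H = {}\<close> by simp
  next
    case (insert w U)
    define E' where "E' = {e \<in> E\<^sub>H. w \<notin> e}"
    define r where "r = card {e \<in> E\<^sub>H. w \<in> e}"
    have E: "e \<in> nsets (insert w U) 3" if "e \<in> E\<^sub>H" for e
      using insert.prems that by (auto simp: uniform3_def)
    have "E\<^sub>H \<subseteq> Pow (insert w U)" using E by (auto simp: nsets_def)
    then have finE: "finite E\<^sub>H" using insert.hyps by (meson finite_Pow_iff finite_insert finite_subset)
    have card_E: "card E\<^sub>H = card E' + r"
    proof -
      have "E\<^sub>H = E' \<union> {e \<in> E\<^sub>H. w \<in> e}" "E' \<inter> {e \<in> E\<^sub>H. w \<in> e} = {}" by (auto simp: E'_def)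
      then show ?thesis unfolding r_def using finE by (metis card_Un_disjoint finite_Un)
    qed
    have card_wU: "card (insert w U) = card U + 1" using insert.hyps by simp
    have IH: "\<bar>real (card (embeddings U E' V E)) - n ^ card U * q ^ card E'\<bar> \<le> real (card U) * M * n ^ card U * q ^ card E'"
    proof (rule insert.IH)
      show "uniform3 U E'" using insert.hyps E by (fastforce simp: uniform3_def E'_def nsets_def)
      show "linear_hypergraph E'" using insert.prems(2) by (auto simp: linear_hypergraph_def E'_def)
      have "connector (insert w U) E\<^sub>H e" if "connector U E' e" for e
        using that by (rule connector_mono) (auto simp: E'_def)
      then show "connector_free U E'" using insert.prems(3) by (auto simp: connector_free_def)
      show "card U \<le> k" using insert.prems(4) card_wU by simp
    qed
    have step: "\<bar>real (card (embeddings (insert w U) E\<^sub>H V E)) - n * q ^ r * real (card (embeddings U E' V E))\<bar>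
      \<le> M * n ^ card (insert w U) * q ^ card E\<^sub>H"
      unfolding n_def M_def r_def E'_def
      by (rule embeddings_step[OF V bdd C q insert.prems(1-3) insert.hyps(2) insert.prems(4) tuples \<tau> big])
    have "\<bar>n * q ^ r * real (card (embeddings U E' V E)) - n ^ card (insert w U) * q ^ card E\<^sub>H\<bar>
      = n * q ^ r * \<bar>real (card (embeddings U E' V E)) - n ^ card U * q ^ card E'\<bar>"
    proof -
      have "n * q ^ r * real (card (embeddings U E' V E)) - n ^ card (insert w U) * q ^ card E\<^sub>H
        = n * q ^ r * (real (card (embeddings U E' V E)) - n ^ card U * q ^ card E')"
        by (simp add: card_wU card_E power_add algebra_simps del: card_insert_disjoint)
      then show ?thesis using q by (simp add: abs_mult n_def)
    qed
    also have "\<dots> \<le> n * q ^ r * (real (card U) * M * n ^ card U * q ^ card E')"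
      using q by (intro mult_left_mono IH) (auto simp: n_def)
    also have "\<dots> = real (card U) * M * n ^ card (insert w U) * q ^ card E\<^sub>H"
      by (simp add: card_wU card_E power_add algebra_simps del: card_insert_disjoint)
    finally have "\<bar>real (card (embeddings (insert w U) E\<^sub>H V E)) - n ^ card (insert w U) * q ^ card E\<^sub>H\<bar>
      \<le> M * n ^ card (insert w U) * q ^ card E\<^sub>H + real (card U) * M * n ^ card (insert w U) * q ^ card E\<^sub>H"
      using step by linarith
    also have "\<dots> = real (card (insert w U)) * M * n ^ card (insert w U) * q ^ card E\<^sub>H"
      unfolding card_wU by (simp add: algebra_simps)
    finally show ?case .
  qed
  then show ?thesis by (simp add: n_def M_def)
qed

section \<open>From pseudorandomness to tuples\<close>

lemma card_edges_between:
  assumes "finite X" "finite Y"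
  shows "real (card (edges_between E X Y)) = (\<Sum>S\<in>X. \<Sum>v\<in>Y. of_bool (S \<union> {v} \<in> E))"
proof -
  have "edges_between E X Y = {x \<in> X \<times> Y. fst x \<union> {snd x} \<in> E}"
    by (auto simp: edges_between_def)
  then have "real (card (edges_between E X Y)) = (\<Sum>x\<in>X \<times> Y. of_bool (fst x \<union> {snd x} \<in> E))"
    using assms by (simp add: sum_of_bool_eq Int_def)
  then show ?thesis by (simp add: sum.cartesian_product case_prod_unfold)
qed

text \<open>The size restriction is removed on one side at a time, for \<open>X\<close> with
  \<open>Y\<close> still large and then for \<open>Y\<close>. Each removal costs
  \<open>2 ^ (j + 1)\<close>, together \<open>4 ^ (j + 1)\<close>.\<close>

lemma Q'_discrepancy:
  assumes V: "finite V" and Q': "Q' \<eta> \<delta> q V E" and \<eta>: "\<eta> < 1" and \<delta>: "0 \<le> \<delta>" and q: "0 \<le> q"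
    and big: "2 \<le> (1 - \<eta>) * real (card V)" "2 \<le> (1 - \<eta>) * real (card V choose 2)"
    and j: "2 \<le> 2 ^ j * (1 - \<eta>)"
    and X: "X \<subseteq> nsets V 2" and Y: "Y \<subseteq> V"
  shows "\<bar>\<Sum>S\<in>X. \<Sum>v\<in>Y. of_bool (S \<union> {v} \<in> E) - q\<bar>
    \<le> 4 ^ (j + 1) * \<delta> * q * real (card V choose 2) * real (card V)"
proof -
  let ?N = "real (card V choose 2)" and ?n = "real (card V)"
  let ?g = "\<lambda>S v. of_bool (S \<union> {v} \<in> E) - q"
  have finP: "finite (nsets V 2)" using V by (rule finite_imp_finite_nsets)
  have large: "\<bar>\<Sum>S\<in>X. \<Sum>v\<in>Y. ?g S v\<bar> \<le> \<delta> * q * ?N * ?n"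
    if X: "X \<subseteq> nsets V 2" "\<eta> * real (card (nsets V 2)) \<le> real (card X)" and Y: "Y \<subseteq> V" "\<eta> * ?n \<le> real (card Y)" for X Y
  proof -
    have fin: "finite X" "finite Y" using X Y finP V finite_subset by auto
    have "(\<Sum>S\<in>X. \<Sum>v\<in>Y. ?g S v) = real (card (edges_between E X Y)) - q * real (card X) * real (card Y)"
      by (simp add: card_edges_between[OF fin] sum_subtractf)
    moreover have "(1 - \<delta>) * q * real (card X) * real (card Y) \<le> real (card (edges_between E X Y))"
      "real (card (edges_between E X Y)) \<le> (1 + \<delta>) * q * real (card X) * real (card Y)"
      using Q' X Y unfolding Q'_def by simp_all
    ultimately have "\<bar>\<Sum>S\<in>X. \<Sum>v\<in>Y. ?g S v\<bar> \<le> \<delta> * q * (real (card X) * real (card Y))"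
      by (simp add: algebra_simps abs_le_iff)
    also have "\<dots> \<le> \<delta> * q * (?N * ?n)"
      using card_mono[OF finP X(1)] card_mono[OF V Y(1)] \<delta> q by (intro mult_left_mono mult_mono) auto
    finally show ?thesis by (simp add: mult.assoc)
  qed
  have Y_large: "\<bar>\<Sum>S\<in>X. \<Sum>v\<in>Y. ?g S v\<bar> \<le> 2 ^ (j + 1) * (\<delta> * q * ?N * ?n)"
    if "Y \<subseteq> V" "\<eta> * ?n \<le> real (card Y)" for Y
    by (rule abs_sum_le_of_large_subsets[OF finP large \<eta> _ j X]) (use that big in auto)
  have "\<bar>\<Sum>v\<in>Y. \<Sum>S\<in>X. ?g S v\<bar> \<le> 2 ^ (j + 1) * (2 ^ (j + 1) * (\<delta> * q * ?N * ?n))"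
    by (rule abs_sum_le_of_large_subsets[OF V _ \<eta> big(1) j Y], subst sum.swap, rule Y_large)
  also have "2 ^ (j + 1) * (2 ^ (j + 1) * (\<delta> * q * ?N * ?n)) = 4 ^ (j + 1) * \<delta> * q * ?N * ?n"
  proof -
    have "(4::real) ^ (j + 1) = 2 ^ (j + 1) * 2 ^ (j + 1)"
      by (simp flip: power_mult_distrib)
    then show ?thesis by (simp only: mult.assoc)
  qed
  finally show ?thesis by (subst sum.swap)
qed

lemma tuple_uniform_of_jumbled:
  assumes V: "finite V" and J: "jumbled p \<beta> V E\<^sub>\<Gamma>" and sub: "E\<^sub>G \<subseteq> E\<^sub>\<Gamma>" and bdd: "BDD k C q V E\<^sub>G"
    and disc: "\<And>X Y. X \<subseteq> nsets V 2 \<Longrightarrow> Y \<subseteq> V \<Longrightarrow> \<bar>\<Sum>S\<in>X. \<Sum>v\<in>Y. of_bool (S \<union> {v} \<in> E\<^sub>G) - q\<bar>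
      \<le> \<delta> * q * real (card V choose 2) * real (card V)"
    and C: "1 \<le> C" and k: "1 \<le> k" and q: "0 < q" "q \<le> 1" and \<alpha>: "0 < \<alpha>" "\<alpha> * p \<le> q" and p: "0 < p"
    and \<beta>: "\<beta> \<le> \<gamma> * p\<^sup>2 * real (card V) powr (3 / 2)"
    and pos: "0 \<le> \<delta>" "0 \<le> \<gamma>" "0 \<le> \<theta>"
    and small: "\<delta> \<le> \<theta> / 4" "C\<^sup>2 * (2 * \<delta> + 8 * \<gamma> / \<alpha>) / \<alpha> \<le> (\<theta> / 4)\<^sup>2"
    and big: "3 \<le> card V" "1 \<le> real (card V) * q\<^sup>2"
  shows "tuple_uniform k (sqrt (3 * sqrt (\<theta> * real k * (1 + real k ^ k * (1 + C\<^sup>2))))) q V E\<^sub>G TYPE('i)"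
proof -
  define n where "n = real (card V)"
  define N where "N = real (card V choose 2)"
  define g :: "'a set \<Rightarrow> 'a \<Rightarrow> real" where "g = (\<lambda>S v. of_bool (S \<union> {v} \<in> E\<^sub>G))"
  define h :: "'a set \<Rightarrow> 'a \<Rightarrow> real" where "h = (\<lambda>S v. of_bool (S \<union> {v} \<in> E\<^sub>\<Gamma>))"
  \<comment> \<open>No sign of \<beta> is given, so its upper bound, written with
    \<open>n * sqrt n\<close> for the power 3/2, takes its place.\<close>
  define \<beta>0 where "\<beta>0 = \<gamma> * p\<^sup>2 * (n * sqrt n)"
  have finP: "finite (nsets V 2)" using V by (rule finite_imp_finite_nsets)
  have n: "3 \<le> n" using big by (simp add: n_def)
  have N: "N = n * (n - 1) / 2"
  proof -
    have "even (card V * (card V - 1))" by (cases "card V") simp_all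
    then have "2 * (card V choose 2) = card V * (card V - 1)" by (simp only: choose_two dvd_mult_div_cancel)
    then have "real (2 * (card V choose 2)) = real (card V * (card V - 1))" by simp
    then show ?thesis using big by (simp add: n_def N_def of_nat_diff)
  qed
  have "n * 2 \<le> n * (n - 1)" using n by (intro mult_left_mono) auto
  then have Nn: "n \<le> N" by (simp add: N)
  have "n powr (3 / 2) = n powr (1 + 1 / 2)" by simp
  also have "\<dots> = n * sqrt n" using n by (simp only: powr_add powr_half_sqrt) simp
  finally have \<beta>0: "\<beta> \<le> \<beta>0" "0 \<le> \<beta>0" using \<beta> pos n by (auto simp: \<beta>0_def n_def)
  have prod_g: "(\<Sum>v\<in>V. \<Prod>i\<in>L. g (f i) v) = real (card (common_nbhd V E\<^sub>G L f))" if "finite L" for L and f :: "'j \<Rightarrow> 'a set"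
  proof -
    have "(\<Prod>i\<in>L. g (f i) v) = of_bool (\<forall>i\<in>L. f i \<union> {v} \<in> E\<^sub>G)" for v
      using that by (induction L rule: finite_induct) (auto simp: g_def)
    then show ?thesis
      using V by (simp add: sum_of_bool_eq Int_def common_nbhd_def)
  qed
  interpret sparse_bipartite "nsets V 2" V g h C q p \<beta>0 \<delta> k
  proof
    fix S :: "'a set" and v
    show "g S v \<in> {0, 1}" by (simp add: g_def)
    show "g S v \<le> h S v" using sub by (auto simp: g_def h_def)
  next
    fix Q assume Q: "Q \<subseteq> nsets V 2" "1 \<le> card Q" "card Q \<le> k"
    then have "finite Q" "Q \<noteq> {}" using card.infinite by fastforce+
    moreover from this have "common_nbhd V E\<^sub>G Q (\<lambda>S. S) = (\<Inter>S\<in>Q. nbhd V E\<^sub>G S)"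
      by (auto simp: common_nbhd_def nbhd_def)
    ultimately show "(\<Sum>v\<in>V. \<Prod>S\<in>Q. g S v) \<le> C * real (card V) * q ^ card Q"
      using bdd Q prod_g[of Q "\<lambda>S. S"] unfolding BDD_def by auto
  next
    fix X Y assume X: "X \<subseteq> nsets V 2" and Y: "Y \<subseteq> V"
    have fin: "finite X" "finite Y" using X Y finP V finite_subset by auto
    have "(\<Sum>S\<in>X. \<Sum>v\<in>Y. h S v - p) = real (card (edges_between E\<^sub>\<Gamma> X Y)) - p * real (card X) * real (card Y)"
      by (simp add: card_edges_between[OF fin] sum_subtractf h_def)
    also have "\<bar>\<dots>\<bar> \<le> \<beta> * sqrt (real (card X) * real (card Y))"
      using J X Y by (simp add: jumbled_def)
    also have "\<dots> \<le> \<beta>0 * sqrt (real (card X) * real (card Y))"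
      using \<beta>0 by (intro mult_right_mono) auto
    finally show "\<bar>\<Sum>S\<in>X. \<Sum>v\<in>Y. h S v - p\<bar> \<le> \<beta>0 * sqrt (real (card X) * real (card Y))" .
    show "\<bar>\<Sum>S\<in>X. \<Sum>v\<in>Y. g S v - q\<bar> \<le> \<delta> * q * real (card (nsets V 2)) * real (card V)"
      using disc[OF X Y] by (simp add: g_def)
  qed (use V finP C q p \<beta>0 pos k in auto)
  have cardP: "real (card (nsets V 2)) = N" by (simp add: N_def)
  have "n\<^sup>2 \<le> 4 * N"
  proof -
    have "2 * n \<le> n * n" using n by (intro mult_right_mono) auto
    then show ?thesis by (simp add: N power2_eq_square algebra_simps)
  qed
  then have "sqrt (n\<^sup>2) \<le> sqrt (4 * N)" by (rule real_sqrt_le_mono)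
  then have "n \<le> 2 * sqrt N" using n by (simp add: real_sqrt_mult)
  then have "n * sqrt N \<le> (2 * sqrt N) * sqrt N" using n Nn by (intro mult_right_mono) auto
  moreover have "0 \<le> N" using n Nn by simp
  ultimately have nsN: "n * sqrt N \<le> 2 * N" by (simp add: mult.assoc)
  have pq: "p \<le> q / \<alpha>" using \<alpha> by (simp add: pos_le_divide_eq mult.commute)
  \<comment> \<open>Here the bound on \<beta> has its effect: its \<open>sqrt n\<close> combines
    with \<open>sqrt (n * N)\<close> to give \<open>n * sqrt N\<close>, which is at most
    \<open>2 * N\<close>, so the power of \<open>N\<close> matches the \<open>Q'\<close> term. One
    factor \<open>p\<close> is traded for \<open>q / \<alpha>\<close>.\<close>
  have J_term: "4 * C * \<beta>0 * q * n\<^sup>2 * sqrt (n * N) \<le> p * q\<^sup>2 * n ^ 3 * N * (C * (8 * \<gamma> / \<alpha>))"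
  proof -
    have "4 * C * \<beta>0 * q * n\<^sup>2 * sqrt (n * N) = 4 * C * \<gamma> * p\<^sup>2 * q * n ^ 3 * ((sqrt n * sqrt n) * sqrt N)"
      unfolding \<beta>0_def real_sqrt_mult by (simp add: power2_eq_square power3_eq_cube mult_ac)
    also have "\<dots> = 4 * C * \<gamma> * p\<^sup>2 * q * n ^ 3 * (n * sqrt N)" using n by simp
    also have "\<dots> \<le> 4 * C * \<gamma> * p\<^sup>2 * q * n ^ 3 * (2 * N)"
      using C pos q n by (intro mult_left_mono nsN) auto
    also have "\<dots> = 8 * C * \<gamma> * p * q * n ^ 3 * N * p"
      by (simp add: power2_eq_square mult_ac)
    also have "\<dots> \<le> 8 * C * \<gamma> * p * q * n ^ 3 * N * (q / \<alpha>)"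
      using C pos p q n Nn by (intro mult_left_mono pq) auto
    also have "\<dots> = p * q\<^sup>2 * n ^ 3 * N * (C * (8 * \<gamma> / \<alpha>))"
      by (simp add: power2_eq_square mult_ac)
    finally show ?thesis .
  qed
  have "C * n * q * N * (p * (2 * C * \<delta> * q\<^sup>2 * N * n ^ 3) + 4 * C * \<beta>0 * q * n\<^sup>2 * sqrt (n * N))
    \<le> C * n * q * N * (p * (2 * C * \<delta> * q\<^sup>2 * N * n ^ 3) + p * q\<^sup>2 * n ^ 3 * N * (C * (8 * \<gamma> / \<alpha>)))"
    using C n q Nn by (intro mult_left_mono add_left_mono J_term) auto
  also have "\<dots> = q ^ 3 * n ^ 4 * N\<^sup>2 * (C\<^sup>2 * (2 * \<delta> + 8 * \<gamma> / \<alpha>)) * p"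
    by (simp add: power2_eq_square power3_eq_cube power4_eq_xxxx algebra_simps)
  \<comment> \<open>The remaining \<open>p\<close> is traded as well, which explains the outer
    division by \<alpha> in \<open>small\<close>.\<close>
  also have "\<dots> \<le> q ^ 3 * n ^ 4 * N\<^sup>2 * (C\<^sup>2 * (2 * \<delta> + 8 * \<gamma> / \<alpha>)) * (q / \<alpha>)"
    using pos \<alpha> q n by (intro mult_left_mono pq) auto
  also have "\<dots> = q ^ 4 * n ^ 4 * N\<^sup>2 * (C\<^sup>2 * (2 * \<delta> + 8 * \<gamma> / \<alpha>) / \<alpha>)"
    by (simp add: power3_eq_cube power4_eq_xxxx)
  also have "\<dots> \<le> q ^ 4 * n ^ 4 * N\<^sup>2 * (\<theta> / 4)\<^sup>2"
    using q n by (intro mult_left_mono small) auto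
  also have "\<dots> = (\<theta> / 4 * q\<^sup>2 * N * n\<^sup>2)\<^sup>2"
    by (simp add: power2_eq_square power4_eq_xxxx)
  finally have \<kappa>: "C * n * q * N * (p * (2 * C * \<delta> * q\<^sup>2 * N * n ^ 3) + 4 * C * \<beta>0 * q * n\<^sup>2 * sqrt (n * N))
    \<le> (\<theta> / 4 * q\<^sup>2 * N * n\<^sup>2)\<^sup>2" .
  \<comment> \<open>With \<kappa> = \<theta>/4 and \<delta> \<le> \<theta>/4, the factor 2(\<kappa>
    + \<delta>) is at most \<theta>.\<close>
  have "(\<Sum>v\<in>V. \<Sum>u\<in>V. \<bar>codeg u v - q\<^sup>2 * N\<bar>) \<le> 2 * (\<theta> / 4 + \<delta>) * q\<^sup>2 * N * n\<^sup>2"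
    using sum_codeg_close[of "\<theta> / 4"] \<kappa> pos unfolding cardP n_def by simp
  also have "\<dots> \<le> \<theta> * q\<^sup>2 * N * n\<^sup>2"
    using small n Nn by (intro mult_right_mono) auto
  finally have cd: "(\<Sum>v\<in>V. \<Sum>u\<in>V. \<bar>codeg u v - q\<^sup>2 * N\<bar>) \<le> \<theta> * q\<^sup>2 * N * n\<^sup>2" .
  have "(\<Sum>v\<in>V. \<bar>deg v - q * N\<bar>) \<le> (2 * \<delta>) * q * N * n"
    using sum_deg_close unfolding cardP n_def by simp
  also have "\<dots> \<le> \<theta> * q * N * n"
    using small pos n Nn q by (intro mult_right_mono) auto
  finally have d: "(\<Sum>v\<in>V. \<bar>deg v - q * N\<bar>) \<le> \<theta> * q * N * n" .
  have "n * q\<^sup>2 \<le> N * q\<^sup>2" using Nn by (intro mult_right_mono) auto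
  then have big': "1 \<le> N * q\<^sup>2" using big by (simp add: n_def)
  show ?thesis
    unfolding tuple_uniform_def
  proof (intro allI impI)
    fix L :: "'i set" assume L: "finite L" "2 * card L \<le> k"
    show "(\<Sum>f\<in>L \<rightarrow>\<^sub>E nsets V 2. \<bar>real (card (common_nbhd V E\<^sub>G L f)) - real (card V) * q ^ card L\<bar>)
       \<le> sqrt (3 * sqrt (\<theta> * real k * (1 + real k ^ k * (1 + C\<^sup>2)))) * real (card V) * (real (card V choose 2) * q) ^ card L"
      using tuples_close[OF L pos(3)] d cd big' unfolding cardP prod_g[OF L(1)] n_def N_def by simp
  qed
qed

section \<open>Choice of constants and of the range of n\<close>

lemma eventually_large:
  fixes p :: "nat \<Rightarrow> real"
  assumes lim: "filterlim (\<lambda>n. p n * real n powr (1 / real k)) at_top sequentially" and k: "1 \<le> k" and \<alpha>: "0 < \<alpha>"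
  shows "\<forall>\<^sub>F n in sequentially. 0 < p n \<and> M \<le> real n * (\<alpha> * p n) ^ k"
proof -
  \<comment> \<open>The lower bound 1 makes \<open>p n\<close> positive and lets the base be
    compared with its \<open>k\<close>-th power, so that a bound \<open>M\<close> on the base passes
    to the power.\<close>
  define A where "A = max 1 M / \<alpha>"
  have A: "0 < A" using \<alpha> by (simp add: A_def)
  have "\<forall>\<^sub>F n in sequentially. A \<le> p n * real n powr (1 / real k)"
    using lim by (simp add: filterlim_at_top)
  then show ?thesis
    using eventually_ge_at_top[of 1]
  proof eventually_elim
    case (elim n)
    have n: "0 < real n" using elim by simp
    have "0 < p n * real n powr (1 / real k)" using elim A by linarith
    then have p: "0 < p n" using n by (simp add: zero_less_mult_iff)
    have "max 1 M \<le> \<alpha> * (p n * real n powr (1 / real k))"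
      using elim \<alpha> by (simp add: A_def pos_divide_le_eq mult.commute)
    then have 1: "1 \<le> \<alpha> * (p n * real n powr (1 / real k))" "M \<le> \<alpha> * (p n * real n powr (1 / real k))"
      by simp_all
    then have "M \<le> (\<alpha> * (p n * real n powr (1 / real k))) ^ k"
      using self_le_power[OF 1(1), of k] k by linarith
    also have "\<dots> = real n * (\<alpha> * p n) ^ k"
    proof -
      have "(real n powr (1 / real k)) ^ k = real n"
        using n k by (simp add: powr_realpow[symmetric] powr_powr)
      then show ?thesis by (simp add: power_mult_distrib mult_ac)
    qed
    finally show ?case using p by simp
  qed
qed

theorem theorem2p1:
  fixes \<epsilon> \<alpha> \<eta> C :: real and k :: nat
  assumes "0 < \<epsilon>" "\<epsilon> < 1" and "0 < \<alpha>" "\<alpha> < 1" and "0 < \<eta>" "\<eta> < 1"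
    and "C > 1" and "k \<ge> 4"
  shows "\<exists>\<delta> > 0. \<exists>\<gamma> > 0. \<forall>p :: nat \<Rightarrow> real.
    filterlim (\<lambda>n. p n * real n powr (1 / real k)) at_top sequentially \<longrightarrow>
    p \<longlonglongrightarrow> 0 \<longrightarrow>
    (\<forall>\<^sub>F n in sequentially. \<forall>q \<beta> :: real.
       \<alpha> * p n \<le> q \<longrightarrow> q \<le> p n \<longrightarrow> \<beta> \<le> \<gamma> * (p n)\<^sup>2 * real n powr (3 / 2) \<longrightarrow>
       (\<forall>(V :: 'a set) E\<^sub>\<Gamma> E\<^sub>G.
          uniform3 V E\<^sub>\<Gamma> \<longrightarrow> card V = n \<longrightarrow> jumbled (p n) \<beta> V E\<^sub>\<Gamma> \<longrightarrow>
          E\<^sub>G \<subseteq> E\<^sub>\<Gamma> \<longrightarrow> real (card E\<^sub>G) = q * real (n choose 3) \<longrightarrow>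
          Q' \<eta> \<delta> q V E\<^sub>G \<longrightarrow> BDD k C q V E\<^sub>G \<longrightarrow>
          (\<forall>(V\<^sub>H :: 'b set) E\<^sub>H.
             uniform3 V\<^sub>H E\<^sub>H \<longrightarrow> card V\<^sub>H = k \<longrightarrow>
             linear_hypergraph E\<^sub>H \<longrightarrow> connector_free V\<^sub>H E\<^sub>H \<longrightarrow>
             \<bar>real (card (embeddings V\<^sub>H E\<^sub>H V E\<^sub>G)) - real n ^ k * q ^ card E\<^sub>H\<bar>
               < \<epsilon> * real n ^ k * q ^ card E\<^sub>H)))"
proof -
  \<comment> \<open>Chosen so that the total error
    \<open>real k * (2 * (2 * C) ^ k * \<tau>)\<close> is \<epsilon>/2; the other half of \<epsilon>
    gives the strict inequality. Then \<theta> solves sqrt(3 sqrt(\<theta> K)) = \<tau>.\<close>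
  define \<tau> where "\<tau> = \<epsilon> / (4 * real k * (2 * C) ^ k)"
  define K where "K = real k * (1 + real k ^ k * (1 + C\<^sup>2))"
  define \<theta> where "\<theta> = (\<tau>\<^sup>2 / 3)\<^sup>2 / K"
  \<comment> \<open>In \<open>small\<close>, the \<delta>' term and the \<gamma> term each receive
    half of (\<theta>/4)^2, that is \<theta>^2/32. Dividing \<delta>' by \<open>4 ^ (j + 1)\<close>
    below pays for removing the size restriction of \<open>Q'\<close>.\<close>
  define \<delta>' where "\<delta>' = min (\<theta> / 4) (\<alpha> * \<theta>\<^sup>2 / (64 * C\<^sup>2))"
  define \<gamma> where "\<gamma> = \<alpha>\<^sup>2 * \<theta>\<^sup>2 / (256 * C\<^sup>2)"
  obtain j :: nat where "2 / (1 - \<eta>) < 2 ^ j"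
    using real_arch_pow[of 2 "2 / (1 - \<eta>)"] by auto
  then have j: "2 \<le> 2 ^ j * (1 - \<eta>)" using assms by (simp add: pos_divide_less_eq)
  define \<delta> where "\<delta> = \<delta>' / 4 ^ (j + 1)"
  have \<tau>: "0 < \<tau>" using assms by (simp add: \<tau>_def)
  have K: "0 < K" using assms unfolding K_def by (intro mult_pos_pos add_pos_nonneg) auto
  have \<theta>: "0 < \<theta>" using \<tau> K by (simp add: \<theta>_def)
  have \<delta>': "0 < \<delta>'" using \<theta> assms by (simp add: \<delta>'_def)
  have \<delta>: "0 < \<delta>" using \<delta>' by (simp add: \<delta>_def)
  have \<gamma>: "0 < \<gamma>" using \<theta> assms by (simp add: \<gamma>_def)
  have \<tau>_eq: "sqrt (3 * sqrt (\<theta> * real k * (1 + real k ^ k * (1 + C\<^sup>2)))) = \<tau>"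
  proof -
    have "\<theta> * real k * (1 + real k ^ k * (1 + C\<^sup>2)) = (\<tau>\<^sup>2 / 3)\<^sup>2"
      using K unfolding \<theta>_def mult.assoc K_def[symmetric] by simp
    then show ?thesis using \<tau> by simp
  qed
  have small: "C\<^sup>2 * (2 * \<delta>' + 8 * \<gamma> / \<alpha>) / \<alpha> \<le> (\<theta> / 4)\<^sup>2"
  proof -
    have "C\<^sup>2 * (2 * \<delta>' + 8 * \<gamma> / \<alpha>) / \<alpha> \<le> C\<^sup>2 * (2 * (\<alpha> * \<theta>\<^sup>2 / (64 * C\<^sup>2)) + 8 * \<gamma> / \<alpha>) / \<alpha>"
      using assms by (intro divide_right_mono mult_left_mono add_right_mono) (auto simp: \<delta>'_def)
    also have "\<dots> = (\<theta> / 4)\<^sup>2"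
      using assms by (simp add: \<gamma>_def field_simps power2_eq_square)
    finally show ?thesis .
  qed
  show ?thesis
  proof (rule exI[of _ \<delta>], intro conjI \<delta>, rule exI[of _ \<gamma>], intro conjI \<gamma> allI impI)
    fix p :: "nat \<Rightarrow> real"
    assume lim: "filterlim (\<lambda>n. p n * real n powr (1 / real k)) at_top sequentially" and p0: "p \<longlonglongrightarrow> 0"
    have "\<forall>\<^sub>F n in sequentially. p n < 1"
      using order_tendstoD(2)[OF p0, of 1] by simp
    \<comment> \<open>The 1 yields n q^2 \<ge> n q^k \<ge> 1 for the moment bounds;
      \<open>real k / \<tau>\<close> makes the vertices already used negligible.\<close>
    moreover have "\<forall>\<^sub>F n in sequentially. 0 < p n \<and> max 1 (real k / \<tau>) \<le> real n * (\<alpha> * p n) ^ k"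
      using assms by (intro eventually_large lim) auto
    moreover have "\<forall>\<^sub>F n in sequentially. max 3 (nat \<lceil>2 / (1 - \<eta>)\<rceil>) \<le> n"
      by (rule eventually_ge_at_top)
    ultimately show "\<forall>\<^sub>F n in sequentially. \<forall>q \<beta> :: real.
       \<alpha> * p n \<le> q \<longrightarrow> q \<le> p n \<longrightarrow> \<beta> \<le> \<gamma> * (p n)\<^sup>2 * real n powr (3 / 2) \<longrightarrow>
       (\<forall>(V :: 'a set) E\<^sub>\<Gamma> E\<^sub>G.
          uniform3 V E\<^sub>\<Gamma> \<longrightarrow> card V = n \<longrightarrow> jumbled (p n) \<beta> V E\<^sub>\<Gamma> \<longrightarrow>
          E\<^sub>G \<subseteq> E\<^sub>\<Gamma> \<longrightarrow> real (card E\<^sub>G) = q * real (n choose 3) \<longrightarrow>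
          Q' \<eta> \<delta> q V E\<^sub>G \<longrightarrow> BDD k C q V E\<^sub>G \<longrightarrow>
          (\<forall>(V\<^sub>H :: 'b set) E\<^sub>H.
             uniform3 V\<^sub>H E\<^sub>H \<longrightarrow> card V\<^sub>H = k \<longrightarrow>
             linear_hypergraph E\<^sub>H \<longrightarrow> connector_free V\<^sub>H E\<^sub>H \<longrightarrow>
             \<bar>real (card (embeddings V\<^sub>H E\<^sub>H V E\<^sub>G)) - real n ^ k * q ^ card E\<^sub>H\<bar>
               < \<epsilon> * real n ^ k * q ^ card E\<^sub>H))"
    proof eventually_elim
      case (elim n)
      have p: "0 < p n" "p n < 1" and n: "3 \<le> n" using elim by auto
      have "2 / (1 - \<eta>) \<le> real n" using elim by linarith
      then have n\<eta>: "2 \<le> (1 - \<eta>) * real n" using assms by (simp add: pos_divide_le_eq mult.commute)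
      have "n * 2 \<le> n * (n - 1)" using n by (intro mult_left_mono) auto
      from div_le_mono[OF this, of 2] have "n \<le> n choose 2" by (simp add: choose_two)
      then have "(1 - \<eta>) * real n \<le> (1 - \<eta>) * real (n choose 2)" using assms by (intro mult_left_mono) auto
      then have N\<eta>: "2 \<le> (1 - \<eta>) * real (n choose 2)" using n\<eta> by simp
      show ?case
      proof (intro allI impI)
        fix q \<beta> :: real and V :: "'a set" and E\<^sub>\<Gamma> E\<^sub>G and V\<^sub>H :: "'b set" and E\<^sub>H
        assume q: "\<alpha> * p n \<le> q" "q \<le> p n" and \<beta>: "\<beta> \<le> \<gamma> * (p n)\<^sup>2 * real n powr (3 / 2)"
          and \<Gamma>: "uniform3 V E\<^sub>\<Gamma>" "card V = n" "jumbled (p n) \<beta> V E\<^sub>\<Gamma>"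
          and G: "E\<^sub>G \<subseteq> E\<^sub>\<Gamma>" "Q' \<eta> \<delta> q V E\<^sub>G" "BDD k C q V E\<^sub>G"
          and H: "uniform3 V\<^sub>H E\<^sub>H" "card V\<^sub>H = k" "linear_hypergraph E\<^sub>H" "connector_free V\<^sub>H E\<^sub>H"
        have V: "finite V" using \<Gamma> by (simp add: uniform3_def)
        have "0 < \<alpha> * p n" using assms p by simp
        then have q01: "0 < q" "q \<le> 1" using q p by linarith+
        have "real n * (\<alpha> * p n) ^ k \<le> real n * q ^ k"
          using q \<open>0 < \<alpha> * p n\<close> by (intro mult_left_mono power_mono) auto
        then have nq: "1 \<le> real n * q ^ k" "real k / \<tau> \<le> real n * q ^ k" using elim by linarith+
        have "real n * q ^ k \<le> real n * q\<^sup>2"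
          using q01 assms by (intro mult_left_mono power_decreasing) auto
        then have nq2: "1 \<le> real n * q\<^sup>2" using nq by simp
        have disc: "\<bar>\<Sum>S\<in>X. \<Sum>v\<in>Y. of_bool (S \<union> {v} \<in> E\<^sub>G) - q\<bar>
            \<le> \<delta>' * q * real (card V choose 2) * real (card V)"
          if "X \<subseteq> nsets V 2" "Y \<subseteq> V" for X Y
          using Q'_discrepancy[OF V G(2) _ _ _ _ _ j that] assms \<delta> q01 n\<eta> N\<eta> \<Gamma>(2)
          by (simp add: \<delta>_def)
        have "tuple_uniform k \<tau> q V E\<^sub>G TYPE('b set)"
          unfolding \<tau>_eq[symmetric]
          by (rule tuple_uniform_of_jumbled[OF V \<Gamma>(3) G(1,3) disc, where \<alpha> = \<alpha> and \<gamma> = \<gamma>])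
            (use assms q q01 p \<beta> \<Gamma> \<delta>' \<gamma> \<theta> small n nq2 in \<open>auto simp: \<delta>'_def\<close>)
        then have "\<bar>real (card (embeddings V\<^sub>H E\<^sub>H V E\<^sub>G)) - real (card V) ^ card V\<^sub>H * q ^ card E\<^sub>H\<bar>
          \<le> real (card V\<^sub>H) * (2 * (2 * C) ^ k * \<tau>) * real (card V) ^ card V\<^sub>H * q ^ card E\<^sub>H"
          using assms q01 \<tau> nq \<Gamma>(2) H
          by (intro embeddings_count[OF V G(3)]) (auto simp: pos_divide_le_eq mult_ac)
        then have "\<bar>real (card (embeddings V\<^sub>H E\<^sub>H V E\<^sub>G)) - real n ^ k * q ^ card E\<^sub>H\<bar>
          \<le> real k * (2 * (2 * C) ^ k * \<tau>) * real n ^ k * q ^ card E\<^sub>H"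
          by (simp add: H(2) \<Gamma>(2))
        also have "real k * (2 * (2 * C) ^ k * \<tau>) = \<epsilon> / 2"
          using assms by (simp add: \<tau>_def)
        also have "\<epsilon> / 2 * real n ^ k * q ^ card E\<^sub>H < \<epsilon> * real n ^ k * q ^ card E\<^sub>H"
          using assms n q01 by (intro mult_strict_right_mono) auto
        finally show "\<bar>real (card (embeddings V\<^sub>H E\<^sub>H V E\<^sub>G)) - real n ^ k * q ^ card E\<^sub>H\<bar>
          < \<epsilon> * real n ^ k * q ^ card E\<^sub>H" .
      qed
    qed
  qed
qed

end
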